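(* Let $K$ be a global field, let $V_{/K}$ be a smooth projective variety over $K$, and let $S$ be a (finite or infinite) collection of endomorphisms of $V$ defined over $K$, equipped with: (1) a common eigendivisor class $\eta\in\operatorname{Pic}(V)\otimes\mathbb{R}$ such that $S$ is height controlled with respect to $\eta$; (2) a probability measure $\nu_1$ on $S$. Let $(\Phi_S,\mathcal{F},\nu)$ be the probability space of i.i.d. sequences of elements of $S$ distributed according to $\nu_1$, and let $h_{V,\eta}:V(\overline{K})\to\mathbb{R}$ be a Weil height function corresponding to $\eta$. Then for all infinite sequences $\gamma\in\Phi_S$ and all points $P\in V(\overline{K})$, the canonical height $$\hat{h}_{V,\eta,P}(\gamma):=\lim_{n\rightarrow\infty}\frac{h_{V,\eta}(\gamma_n\cdot P)}{\deg_\eta(\gamma_n)}$$ converges. Likewise, the expected canonical height at $P$, $$\mathbb{E}_{\nu}\big[\hat{h}_{V,\eta}\big](P):=\int_{\Phi_S}\hat{h}_{V,\eta,P}(\gamma)\,d\nu,$$ converges. Let $$d_{\nu,\eta}:=\bigg(\sum_{\phi\in S}\frac{\nu_1(\phi)}{\deg_{\eta}(\phi)}\bigg)^{-1},$$ and for $k\ge 1$ let $\nu_k^*$ be the probability measure on $\Phi_{S,k}$ given by $$\nu_k^*(\gamma_k):=\frac{\nu_k(\gamma_k)}{\deg_\eta(\gamma_k)}(d_{\nu,\eta})^{k}.$$ Then the function $\mathbb{E}_\nu[\hat{h}_{V,\eta}]: V(\overline{K})\rightarrow\mathbb{R}$ satisfies: (a) $\mathbb{E}_\nu[\hat{h}_{V,\eta}]=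 h_{V,\eta}+O(1)$ on $V(\overline K)$, i.e. the difference is a bounded function; (b) $\mathbb{E}_{\nu_k^*}\Big[\mathbb{E}_{\nu}\big[\hat{h}_{V,\eta}\big](\gamma_k\cdot P)\Big]=(d_{\nu,\eta})^{k}\;\mathbb{E}_{\nu}\big[\hat{h}_{V,\eta}\big](P)$ for all $k\geq1$ and all $P\in V(\overline{K})$, where the outer expectation on the left is over $\gamma_k\in\Phi_{S,k}$ distributed according to $\nu_k^*$.
   Context: Height controlled: for an endomorphism $\phi$ of $V$ with $\phi^*(\eta)=\alpha_\phi\eta$ ($\alpha_\phi\in\mathbb{R}$), put $C(V,\eta,\phi):=\sup_{P\in V(\overline K)}|h_{V,\eta}(\phi(P))-\alpha_\phi h_{V,\eta}(P)|$. The set $S$ is height controlled with respect to $\eta$ if (i) for every $\phi\in S$ there is $\alpha_\phi$ with $\phi^*(\eta)=\alpha_\phi\eta$, and $\inf_{\phi\in S}\alpha_\phi>1$; and (ii) $\sup_{\phi\in S}C(V,\eta,\phi)$ is finite. Sequences: $\Phi_{S,n}=\prod_{i=1}^n S$ and $\Phi_S=\prod_{i=1}^\infty S$. For $\gamma=(\theta_n)_{n\ge1}\in\Phi_S$ let $\gamma_m=(\theta_i)_{i=1}^m\in\Phi_{S,m}$, acting on $V$ by $\gamma_m\cdot P=(\theta_m\circ\theta_{m-1}\circ\cdots\circ\theta_1)(P)$, and put $\deg_\eta(\gamma_m)=\prod_{i=1}^m\alpha_{\theta_i}$; in particular $\deg_\eta(\phi)=\alpha_\phi$ for $\phi\in S$.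 Measures: $S$ is countable (since $K$ is), $\nu_1$ is a discrete probability measure defined on all subsets of $S$, and $\nu_1(\phi)$ is the mass of $\{\phi\}$. $\nu_m$ is the product measure on $\Phi_{S,m}$, $\nu_m((\theta_i)_{i=1}^m)=\prod_{i=1}^m\nu_1(\theta_i)$, and $\nu$ is the infinite product measure on $\Phi_S$ induced by $\nu_1$, with $\mathcal{F}$ the $\sigma$-algebra of $\nu$-measurable sets. *)

theory Defs
  imports
    "HOL-Probability.Probability"
    "HOL-Algebra.Algebraic_Closure_Type"
    "HOL-Library.Poly_Mapping"
    "HOL-Library.Function_Algebras"
begin

section \<open>Global fields\<close>

definition is_subfield :: "'a::field set \<Rightarrow> bool" where
  "is_subfield L \<longleftrightarrow> 0 \<in> L \<and> 1 \<in> L \<and> (\<forall>x\<in>L. inverse x \<in> L) \<and>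
     (\<forall>x\<in>L. \<forall>y\<in>L. x - y \<in> L \<and> x * y \<in> L)"

definition gen_field :: "'a::field set \<Rightarrow> 'a set" where
  "gen_field A = \<Inter>{L. is_subfield L \<and> A \<subseteq> L}"

definition prime_field :: "'a::field set" where
  "prime_field = gen_field {}"

definition spans_over :: "'a::field set \<Rightarrow> 'a set \<Rightarrow> 'a set \<Rightarrow> bool" where
  "spans_over F B L \<longleftrightarrow> finite B \<and> B \<subseteq> L \<and>
     L = {\<Sum>b\<in>B. c b * b | c. \<forall>b\<in>B. c b \<in> F}"

definition finite_extension :: "'a::field set \<Rightarrow> 'a set \<Rightarrow> bool" where
  "finite_extension F L \<longleftrightarrow> is_subfield F \<and> is_subfield L \<and> F \<subseteq> L \<and> (\<exists>B. spans_over F B L)"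

text \<open>The degree \<open>[L : F]\<close> of a finite extension: the least size of a spanning set.\<close>

definition ext_degree :: "'a::field set \<Rightarrow> 'a set \<Rightarrow> nat" where
  "ext_degree F L = (LEAST m. \<exists>B. spans_over F B L \<and> card B = m)"

definition transcendental_over :: "'a::field set \<Rightarrow> 'a \<Rightarrow> bool" where
  "transcendental_over F t \<longleftrightarrow>
     (\<forall>p. (\<forall>i. Polynomial.coeff p i \<in> F) \<longrightarrow> Polynomial.poly p t = 0 \<longrightarrow> p = 0)"

text \<open>A global field is a finite extension of the rationals or of \<open>F\<^sub>p(t)\<close>.\<close>

definition global_field :: "'k::field itself \<Rightarrow> bool" where
  "global_field _ \<longleftrightarrow>
     CHAR('k) = 0 \<and> finite_extension prime_field (UNIV :: 'k set) \<or>
     CHAR('k) \<noteq> 0 \<and> (\<exists>t::'k. transcendental_over prime_field t \<and>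
        finite_extension (gen_field {t}) UNIV)"


section \<open>Projective varieties in the classical language\<close>

text \<open>A point of projective space is the set of all its homogeneous coordinate vectors. A vector
  of length \<open>n + 1\<close> is a function on \<open>nat\<close> vanishing above \<open>n\<close>.\<close>

type_synonym 'a ppoint = "(nat \<Rightarrow> 'a) set"

definition pline :: "(nat \<Rightarrow> 'a::field) \<Rightarrow> 'a ppoint" where
  "pline x = {\<lambda>i. c * x i | c. c \<noteq> 0}"

definition proj_space :: "nat \<Rightarrow> 'a::field ppoint set" where
  "proj_space n = {pline x | x. (\<exists>i. x i \<noteq> 0) \<and> (\<forall>i>n. x i = 0)}"

type_synonym 'a mpoly = "(nat \<Rightarrow>\<^sub>0 nat) \<Rightarrow>\<^sub>0 'a"

definition mp_eval :: "(nat \<Rightarrow> 'a::field) \<Rightarrow> 'a mpoly \<Rightarrow> 'a" where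
  "mp_eval x F = (\<Sum>m\<in>Poly_Mapping.keys F. Poly_Mapping.lookup F m *
     (\<Prod>i\<in>Poly_Mapping.keys m. x i ^ Poly_Mapping.lookup m i))"

definition mp_deriv :: "nat \<Rightarrow> 'a::field mpoly \<Rightarrow> 'a mpoly" where
  "mp_deriv j F = (\<Sum>m\<in>Poly_Mapping.keys F.
     Poly_Mapping.single (m - Poly_Mapping.single j 1)
       (of_nat (Poly_Mapping.lookup m j) * Poly_Mapping.lookup F m))"

text \<open>Polynomials in the variables \<open>X\<^sub>0, \<dots>, X\<^sub>n\<close> with coefficients in \<open>R\<close>.\<close>

definition mpolys :: "nat \<Rightarrow> 'a::field set \<Rightarrow> 'a mpoly set" where
  "mpolys n R = {F. (\<forall>m. Poly_Mapping.lookup F m \<in> R) \<and>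
     (\<forall>m\<in>Poly_Mapping.keys F. Poly_Mapping.keys m \<subseteq> {..n})}"

definition homs :: "nat \<Rightarrow> 'a::field set \<Rightarrow> nat \<Rightarrow> 'a mpoly set" where
  "homs n R d = {F \<in> mpolys n R. \<forall>m\<in>Poly_Mapping.keys F.
     (\<Sum>i\<in>Poly_Mapping.keys m. Poly_Mapping.lookup m i) = d}"

definition vanishes_at :: "'a::field mpoly \<Rightarrow> 'a ppoint \<Rightarrow> bool" where
  "vanishes_at F p \<longleftrightarrow> (\<forall>x\<in>p. mp_eval x F = 0)"

definition zero_locus :: "nat \<Rightarrow> 'a::field mpoly set \<Rightarrow> 'a ppoint set" where
  "zero_locus n T = {p \<in> proj_space n. \<forall>F\<in>T. vanishes_at F p}"

definition proj_closed :: "nat \<Rightarrow> 'a::field ppoint set \<Rightarrow> bool" where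
  "proj_closed n Z \<longleftrightarrow> (\<exists>T \<subseteq> (\<Union>d. homs n UNIV d). Z = zero_locus n T)"

text \<open>Over an infinite field the polynomials vanishing on the affine cone of a nonempty \<open>V\<close> form
  the homogeneous ideal \<open>I(V)\<close>.\<close>

definition van_ideal :: "nat \<Rightarrow> 'a::field ppoint set \<Rightarrow> 'a mpoly set" where
  "van_ideal n V = {F \<in> mpolys n UNIV. \<forall>p\<in>V. vanishes_at F p}"

definition irreducible_closed :: "nat \<Rightarrow> 'a::field ppoint set \<Rightarrow> bool" where
  "irreducible_closed n V \<longleftrightarrow> proj_closed n V \<and> V \<noteq> {} \<and>
     (\<forall>F\<in>mpolys n UNIV. \<forall>G\<in>mpolys n UNIV.
        F * G \<in> van_ideal n V \<longrightarrow> F \<in> van_ideal n V \<or> G \<in> van_ideal n V)"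

text \<open>\<open>I(V)\<close> is generated by homogeneous polynomials with coefficients in the subfield \<open>k\<close>.\<close>

definition defined_over :: "nat \<Rightarrow> 'a::field set \<Rightarrow> 'a ppoint set \<Rightarrow> bool" where
  "defined_over n k V \<longleftrightarrow> (\<forall>F\<in>van_ideal n V.
     \<exists>T A. finite T \<and> T \<subseteq> van_ideal n V \<inter> (\<Union>d. homs n k d) \<and> F = (\<Sum>G\<in>T. A G * G))"

definition var_dim :: "nat \<Rightarrow> 'a::field ppoint set \<Rightarrow> nat" where
  "var_dim n V = (GREATEST d. \<exists>Z :: nat \<Rightarrow> 'a ppoint set.
     (\<forall>i\<le>d. irreducible_closed n (Z i) \<and> Z i \<subseteq> V) \<and> (\<forall>i<d. Z i \<subset> Z (Suc i)))"

text \<open>The Jacobian criterion on the affine cone: at every point the matrix of partial derivatives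
  of the elements of \<open>I(V)\<close> has rank \<open>n - dim V\<close>.\<close>

definition smooth_var :: "nat \<Rightarrow> 'a::field ppoint set \<Rightarrow> bool" where
  "smooth_var n V \<longleftrightarrow> (\<forall>p\<in>V. \<forall>x\<in>p.
     vector_space.dim (\<lambda>c (v :: nat \<Rightarrow> 'a) i. c * v i)
       {(\<lambda>j. mp_eval x (mp_deriv j F)) | F. F \<in> van_ideal n V} + var_dim n V = n)"

definition base_field :: "'k::field alg_closure set" where
  "base_field = to_ac ` UNIV"

text \<open>A smooth projective variety over \<open>K\<close> (type \<open>'k\<close>), embedded in projective \<open>n\<close>-space and
  identified with its set of points over the algebraic closure.\<close>

definition smooth_projective_variety :: "nat \<Rightarrow> 'k::field alg_closure ppoint set \<Rightarrow> bool" where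
  "smooth_projective_variety n V \<longleftrightarrow>
     irreducible_closed n V \<and> defined_over n base_field V \<and> smooth_var n V"

definition open_in_var :: "nat \<Rightarrow> 'a::field ppoint set \<Rightarrow> 'a ppoint set \<Rightarrow> bool" where
  "open_in_var n V U \<longleftrightarrow> (\<exists>Z. proj_closed n Z \<and> U = V - Z)"

definition regular_on :: "nat \<Rightarrow> 'a::field ppoint set \<Rightarrow> 'a ppoint set \<Rightarrow> ('a ppoint \<Rightarrow> 'a) \<Rightarrow> bool" where
  "regular_on n V U f \<longleftrightarrow> (\<forall>p\<in>U. \<exists>W d. \<exists>F\<in>homs n UNIV d. \<exists>G\<in>homs n UNIV d.
     open_in_var n V W \<and> p \<in> W \<and> W \<subseteq> U \<and>
     (\<forall>q\<in>W. \<forall>x\<in>q. mp_eval x G \<noteq> 0 \<and> f q = mp_eval x F / mp_eval x G))"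

definition unit_on :: "nat \<Rightarrow> 'a::field ppoint set \<Rightarrow> 'a ppoint set \<Rightarrow> ('a ppoint \<Rightarrow> 'a) \<Rightarrow> bool" where
  "unit_on n V U f \<longleftrightarrow> regular_on n V U f \<and> (\<forall>p\<in>U. f p \<noteq> 0)"

text \<open>An endomorphism of \<open>V\<close> that is defined over the subfield \<open>k\<close>: near every point it is given by
  forms of equal degree with coefficients in \<open>k\<close> and no common zero. Endomorphisms are extensional,
  so that equality of morphisms is equality of functions.\<close>

definition endomorphism_over ::
    "nat \<Rightarrow> 'a::field set \<Rightarrow> 'a ppoint set \<Rightarrow> ('a ppoint \<Rightarrow> 'a ppoint) \<Rightarrow> bool" where
  "endomorphism_over n k V \<phi> \<longleftrightarrow> \<phi> \<in> V \<rightarrow>\<^sub>E V \<and>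
     (\<forall>p\<in>V. \<exists>W d F. open_in_var n V W \<and> p \<in> W \<and> (\<forall>i\<le>n. F i \<in> homs n k d) \<and>
        (\<forall>q\<in>W. \<forall>x\<in>q. (\<exists>i\<le>n. mp_eval x (F i) \<noteq> 0) \<and>
           \<phi> q = pline (\<lambda>i. if i \<le> n then mp_eval x (F i) else 0)))"


section \<open>The Picard group\<close>

text \<open>A line bundle is given by transition functions on an open cover indexed by the points of \<open>V\<close>,
  with \<open>p \<in> U p\<close> (every open cover has a refinement of this shape). The local sections \<open>s p\<close> of the
  line bundle satisfy \<open>s p = g p q * s q\<close> on \<open>U p \<inter> U q\<close>. Values at indices outside \<open>V\<close> are
  irrelevant; they disappear in the isomorphism classes.\<close>

type_synonym 'a line_bundle =
  "('a ppoint \<Rightarrow> 'a ppoint set) \<times> ('a ppoint \<Rightarrow> 'a ppoint \<Rightarrow> 'a ppoint \<Rightarrow> 'a)"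

definition line_bundle :: "nat \<Rightarrow> 'a::field ppoint set \<Rightarrow> 'a line_bundle \<Rightarrow> bool" where
  "line_bundle n V L \<longleftrightarrow> (case L of (U, g) \<Rightarrow>
     (\<forall>p\<in>V. open_in_var n V (U p) \<and> p \<in> U p) \<and>
     (\<forall>p\<in>V. \<forall>q\<in>V. unit_on n V (U p \<inter> U q) (g p q)) \<and>
     (\<forall>p\<in>V. \<forall>q\<in>V. \<forall>r\<in>V. \<forall>z\<in>U p \<inter> U q \<inter> U r. g p q z * g q r z = g p r z))"

definition lb_iso :: "nat \<Rightarrow> 'a::field ppoint set \<Rightarrow> 'a line_bundle \<Rightarrow> 'a line_bundle \<Rightarrow> bool" where
  "lb_iso n V L L' \<longleftrightarrow> (case (L, L') of ((U, g), (U', g')) \<Rightarrow>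
     (\<exists>h. (\<forall>p\<in>V. unit_on n V (U p \<inter> U' p) (h p)) \<and>
        (\<forall>p\<in>V. \<forall>q\<in>V. \<forall>z\<in>U p \<inter> U' p \<inter> U q \<inter> U' q. h p z * g p q z = g' p q z * h q z)))"

definition lb_trivial :: "'a::field ppoint set \<Rightarrow> 'a line_bundle" where
  "lb_trivial V = ((\<lambda>_. V), (\<lambda>_ _ _. 1))"

definition lb_tensor :: "'a::field line_bundle \<Rightarrow> 'a line_bundle \<Rightarrow> 'a line_bundle" where
  "lb_tensor L L' = (case (L, L') of ((U, g), (U', g')) \<Rightarrow>
     ((\<lambda>p. U p \<inter> U' p), (\<lambda>p q z. g p q z * g' p q z)))"

definition lb_pullback ::
    "'a::field ppoint set \<Rightarrow> ('a ppoint \<Rightarrow> 'a ppoint) \<Rightarrow> 'a line_bundle \<Rightarrow> 'a line_bundle" where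
  "lb_pullback V \<phi> L = (case L of (U, g) \<Rightarrow>
     ((\<lambda>p. {z \<in> V. \<phi> z \<in> U (\<phi> p)}), (\<lambda>p q z. g (\<phi> p) (\<phi> q) (\<phi> z))))"

definition pic_class :: "nat \<Rightarrow> 'a::field ppoint set \<Rightarrow> 'a line_bundle \<Rightarrow> 'a line_bundle set" where
  "pic_class n V L = {M. line_bundle n V M \<and> lb_iso n V L M}"

definition Pic :: "nat \<Rightarrow> 'a::field ppoint set \<Rightarrow> 'a line_bundle set monoid" where
  "Pic n V = \<lparr>carrier = {pic_class n V L | L. line_bundle n V L},
     monoid.mult = (\<lambda>A B. \<Union>L\<in>A. \<Union>L'\<in>B. pic_class n V (lb_tensor L L')),
     one = pic_class n V (lb_trivial V)\<rparr>"

definition pic_pullback :: "nat \<Rightarrow> 'a::field ppoint set \<Rightarrow> ('a ppoint \<Rightarrow> 'a ppoint) \<Rightarrow>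
    'a line_bundle set \<Rightarrow> 'a line_bundle set" where
  "pic_pullback n V \<phi> A = (\<Union>L\<in>A. pic_class n V (lb_pullback V \<phi> L))"


section \<open>Tensoring an abelian group with the reals\<close>

text \<open>For a multiplicatively written abelian group \<open>G\<close>, the real vector space \<open>G \<otimes> \<real>\<close> is the quotient
  of the vector space of formal real combinations of elements of \<open>G\<close> by the subspace spanned by the
  combinations \<open>ab - a - b\<close>.\<close>

inductive_set tensor_rels :: "('g, 'm) monoid_scheme \<Rightarrow> ('g \<Rightarrow>\<^sub>0 real) set" for G where
  zero: "0 \<in> tensor_rels G"
| gen: "a \<in> carrier G \<Longrightarrow> b \<in> carrier G \<Longrightarrow>
    Poly_Mapping.single (a \<otimes>\<^bsub>G\<^esub> b) r - Poly_Mapping.single a r - Poly_Mapping.single b r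
      \<in> tensor_rels G"
| add: "f \<in> tensor_rels G \<Longrightarrow> g \<in> tensor_rels G \<Longrightarrow> f + g \<in> tensor_rels G"

definition formal_sums :: "('g, 'm) monoid_scheme \<Rightarrow> ('g \<Rightarrow>\<^sub>0 real) set" where
  "formal_sums G = {f. Poly_Mapping.keys f \<subseteq> carrier G}"

definition tensor_class :: "('g, 'm) monoid_scheme \<Rightarrow> ('g \<Rightarrow>\<^sub>0 real) \<Rightarrow> ('g \<Rightarrow>\<^sub>0 real) set" where
  "tensor_class G f = {g \<in> formal_sums G. g - f \<in> tensor_rels G}"

definition tensor_reals :: "('g, 'm) monoid_scheme \<Rightarrow> ('g \<Rightarrow>\<^sub>0 real) set set" where
  "tensor_reals G = tensor_class G ` formal_sums G"

definition tensor_scale ::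
    "('g, 'm) monoid_scheme \<Rightarrow> real \<Rightarrow> ('g \<Rightarrow>\<^sub>0 real) set \<Rightarrow> ('g \<Rightarrow>\<^sub>0 real) set" where
  "tensor_scale G r T = (\<Union>f\<in>T. tensor_class G (Poly_Mapping.map (\<lambda>x. r * x) f))"

text \<open>The linear map \<open>u \<otimes> id\<close> on \<open>G \<otimes> \<real>\<close> induced by an endomorphism \<open>u\<close> of \<open>G\<close>.\<close>

definition tensor_map ::
    "('g, 'm) monoid_scheme \<Rightarrow> ('g \<Rightarrow> 'g) \<Rightarrow> ('g \<Rightarrow>\<^sub>0 real) set \<Rightarrow> ('g \<Rightarrow>\<^sub>0 real) set" where
  "tensor_map G u T = (\<Union>f\<in>T. tensor_class G
     (\<Sum>a\<in>Poly_Mapping.keys f. Poly_Mapping.single (u a) (Poly_Mapping.lookup f a)))"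


section \<open>Weil heights\<close>

text \<open>Normalised discrete valuations of a field \<open>L\<close>, as functions on the nonzero elements of \<open>L\<close>.\<close>

definition discrete_valuations :: "'a::field set \<Rightarrow> ('a \<Rightarrow> int) set" where
  "discrete_valuations L = {v \<in> extensional (L - {0}).
     v ` (L - {0}) = UNIV \<and>
     (\<forall>x\<in>L - {0}. \<forall>y\<in>L - {0}. v (x * y) = v x + v y \<and>
        (x + y \<noteq> 0 \<longrightarrow> v (x + y) \<ge> min (v x) (v y)))}"

definition residue_card :: "'a::field set \<Rightarrow> ('a \<Rightarrow> int) \<Rightarrow> nat" where
  "residue_card L v = (let R = {x \<in> L. x = 0 \<or> v x \<ge> 0} in
     card ((\<lambda>x. {y \<in> R. y = x \<or> v (y - x) > 0}) ` R))"

definition complex_embeddings :: "'a::field set \<Rightarrow> ('a \<Rightarrow> complex) set" where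
  "complex_embeddings L = {\<sigma> \<in> extensional L. \<sigma> 1 = 1 \<and>
     (\<forall>x\<in>L. \<forall>y\<in>L. \<sigma> (x + y) = \<sigma> x + \<sigma> y \<and> \<sigma> (x * y) = \<sigma> x * \<sigma> y)}"

text \<open>The sum over all places \<open>w\<close> of \<open>L\<close> of \<open>log (max\<^sub>i \<parallel>x\<^sub>i\<parallel>\<^sub>w)\<close>, where \<open>\<parallel>\<sqdot>\<parallel>\<^sub>w\<close> is the normalised absolute
  value entering the product formula of \<open>L\<close>: at a discrete valuation \<open>v\<close> it is \<open>q powr (- v x)\<close> with \<open>q\<close>
  the size of the residue field; at a real place it is the absolute value, and at a complex place its
  square, whence the sum over all complex embeddings. Almost all terms of the first sum are zero.\<close>

definition field_height :: "'a::field set \<Rightarrow> (nat \<Rightarrow> 'a) \<Rightarrow> real" where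
  "field_height L x =
     (\<Sum>\<^sub>\<infinity>v\<in>discrete_valuations L.
        real_of_int (Max ((\<lambda>i. - v (x i)) ` {i. x i \<noteq> 0})) * ln (real (residue_card L v))) +
     (\<Sum>\<sigma>\<in>complex_embeddings L. ln (Max ((\<lambda>i. cmod (\<sigma> (x i))) ` {i. x i \<noteq> 0})))"

text \<open>The logarithmic Weil height on projective space over the algebraic closure of a global field
  \<open>K\<close>: absolute (divided by the degree over the rationals) if \<open>K\<close> is a number field, relative to \<open>K\<close> if
  \<open>K\<close> is a function field. The value does not depend on the coordinate vector.\<close>

definition proj_height :: "'k::field alg_closure ppoint \<Rightarrow> real" where
  "proj_height p = (let x = (SOME x. x \<in> p); L = gen_field (base_field \<union> x ` UNIV) in
     field_height L x / real (ext_degree (if CHAR('k) = 0 then prime_field else base_field) L))"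

text \<open>The map to projective \<open>m\<close>-space given by \<open>m + 1\<close> global sections without common zero of a line
  bundle.\<close>

definition given_by_sections ::
    "nat \<Rightarrow> 'a::field ppoint set \<Rightarrow> 'a line_bundle \<Rightarrow> nat \<Rightarrow> ('a ppoint \<Rightarrow> 'a ppoint) \<Rightarrow> bool" where
  "given_by_sections n V L m \<psi> \<longleftrightarrow> (case L of (U, g) \<Rightarrow>
     \<exists>s :: nat \<Rightarrow> 'a ppoint \<Rightarrow> 'a ppoint \<Rightarrow> 'a.
       (\<forall>i\<le>m. \<forall>p\<in>V. regular_on n V (U p) (s i p)) \<and>
       (\<forall>i\<le>m. \<forall>p\<in>V. \<forall>q\<in>V. \<forall>z\<in>U p \<inter> U q. s i p z = g p q z * s i q z) \<and>
       (\<forall>p\<in>V. \<forall>z\<in>U p. (\<exists>i\<le>m. s i p z \<noteq> 0) \<and>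
          \<psi> z = pline (\<lambda>i. if i \<le> m then s i p z else 0)))"

text \<open>The Weil height functions attached to \<open>\<eta> \<in> Pic(V) \<otimes> \<real>\<close> by the height machine: for a line bundle
  generated by global sections one pulls back the height on projective space, this is extended
  linearly, and the result is determined up to a bounded function. By the height machine, the
  condition does not depend on how \<open>\<eta>\<close> is written as a combination of line bundles generated by
  global sections.\<close>

definition weil_height :: "nat \<Rightarrow> 'k::field alg_closure ppoint set \<Rightarrow>
    ('k alg_closure line_bundle set \<Rightarrow>\<^sub>0 real) set \<Rightarrow> ('k alg_closure ppoint \<Rightarrow> real) \<Rightarrow> bool" where
  "weil_height n V \<eta> h \<longleftrightarrow>
     (\<exists>(N::nat) (r :: nat \<Rightarrow> real) L m \<psi> B.
        (\<forall>j<N. line_bundle n V (L j) \<and> given_by_sections n V (L j) (m j) (\<psi> j)) \<and>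
        \<eta> = tensor_class (Pic n V) (\<Sum>j<N. Poly_Mapping.single (pic_class n V (L j)) (r j)) \<and>
        (\<forall>p\<in>V. \<bar>h p - (\<Sum>j<N. r j * proj_height (\<psi> j p))\<bar> \<le> B))"

definition height_defect :: "'p set \<Rightarrow> ('p \<Rightarrow> real) \<Rightarrow> real \<Rightarrow> ('p \<Rightarrow> 'p) \<Rightarrow> ereal" where
  "height_defect V h a \<phi> = (SUP p\<in>V. ereal \<bar>h (\<phi> p) - a * h p\<bar>)"

text \<open>The eigenvalues are recorded as a function \<open>\<alpha>\<close> on \<open>S\<close>; they are determined by \<open>\<eta>\<close> if \<open>\<eta>\<close> is nonzero.
  Infimum and supremum are taken in the extended reals.\<close>

definition height_controlled :: "nat \<Rightarrow> 'k::field alg_closure ppoint set \<Rightarrow>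
    ('k alg_closure line_bundle set \<Rightarrow>\<^sub>0 real) set \<Rightarrow> ('k alg_closure ppoint \<Rightarrow> real) \<Rightarrow>
    ('k alg_closure ppoint \<Rightarrow> 'k alg_closure ppoint) set \<Rightarrow>
    (('k alg_closure ppoint \<Rightarrow> 'k alg_closure ppoint) \<Rightarrow> real) \<Rightarrow> bool" where
  "height_controlled n V \<eta> h S \<alpha> \<longleftrightarrow>
     (\<forall>\<phi>\<in>S. tensor_map (Pic n V) (pic_pullback n V \<phi>) \<eta> = tensor_scale (Pic n V) (\<alpha> \<phi>) \<eta>) \<and>
     (INF \<phi>\<in>S. ereal (\<alpha> \<phi>)) > 1 \<and>
     (SUP \<phi>\<in>S. height_defect V h (\<alpha> \<phi>) \<phi>) < \<infinity>"


section \<open>Random orbits and canonical heights\<close>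

text \<open>Sequences are indexed from 0, so \<open>\<gamma> i\<close> is the map \<open>\<theta>\<^sub>i\<^sub>+\<^sub>1\<close>, and elements of \<open>S\<^sup>m\<close> are functions on
  \<open>{..<m}\<close>. The next two functions only use the first \<open>m\<close> entries of \<open>\<gamma>\<close>.\<close>

primrec act :: "(nat \<Rightarrow> 'p \<Rightarrow> 'p) \<Rightarrow> nat \<Rightarrow> 'p \<Rightarrow> 'p" where
  "act \<gamma> 0 p = p"
| "act \<gamma> (Suc m) p = \<gamma> m (act \<gamma> m p)"

definition seq_deg :: "(('p \<Rightarrow> 'p) \<Rightarrow> real) \<Rightarrow> (nat \<Rightarrow> 'p \<Rightarrow> 'p) \<Rightarrow> nat \<Rightarrow> real" where
  "seq_deg \<alpha> \<gamma> m = (\<Prod>i<m. \<alpha> (\<gamma> i))"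

definition height_quotient ::
    "('p \<Rightarrow> real) \<Rightarrow> (('p \<Rightarrow> 'p) \<Rightarrow> real) \<Rightarrow> 'p \<Rightarrow> (nat \<Rightarrow> 'p \<Rightarrow> 'p) \<Rightarrow> nat \<Rightarrow> real" where
  "height_quotient h \<alpha> p \<gamma> m = h (act \<gamma> m p) / seq_deg \<alpha> \<gamma> m"

definition canonical_height ::
    "('p \<Rightarrow> real) \<Rightarrow> (('p \<Rightarrow> 'p) \<Rightarrow> real) \<Rightarrow> 'p \<Rightarrow> (nat \<Rightarrow> 'p \<Rightarrow> 'p) \<Rightarrow> real" where
  "canonical_height h \<alpha> p \<gamma> = lim (height_quotient h \<alpha> p \<gamma>)"

definition seq_measure :: "('p \<Rightarrow> 'p) measure \<Rightarrow> (nat \<Rightarrow> 'p \<Rightarrow> 'p) measure" where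
  "seq_measure \<nu>1 = PiM UNIV (\<lambda>_. \<nu>1)"

definition seq_measure_fin :: "('p \<Rightarrow> 'p) measure \<Rightarrow> nat \<Rightarrow> (nat \<Rightarrow> 'p \<Rightarrow> 'p) measure" where
  "seq_measure_fin \<nu>1 m = PiM {..<m} (\<lambda>_. \<nu>1)"

definition expected_height ::
    "('p \<Rightarrow> 'p) measure \<Rightarrow> ('p \<Rightarrow> real) \<Rightarrow> (('p \<Rightarrow> 'p) \<Rightarrow> real) \<Rightarrow> 'p \<Rightarrow> real" where
  "expected_height \<nu>1 h \<alpha> p = (\<integral>\<gamma>. canonical_height h \<alpha> p \<gamma> \<partial>seq_measure \<nu>1)"

definition d_const :: "('p \<Rightarrow> 'p) measure \<Rightarrow> (('p \<Rightarrow> 'p) \<Rightarrow> real) \<Rightarrow> real" where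
  "d_const \<nu>1 \<alpha> = inverse (\<Sum>\<^sub>\<infinity>\<phi>\<in>space \<nu>1. measure \<nu>1 {\<phi>} / \<alpha> \<phi>)"

definition nu_star ::
    "('p \<Rightarrow> 'p) measure \<Rightarrow> (('p \<Rightarrow> 'p) \<Rightarrow> real) \<Rightarrow> nat \<Rightarrow> (nat \<Rightarrow> 'p \<Rightarrow> 'p) measure" where
  "nu_star \<nu>1 \<alpha> k = point_measure ({..<k} \<rightarrow>\<^sub>E space \<nu>1)
     (\<lambda>\<gamma>. ennreal (measure (seq_measure_fin \<nu>1 k) {\<gamma>} / seq_deg \<alpha> \<gamma> k * d_const \<nu>1 \<alpha> ^ k))"

end

theory Submission
  imports Defs
begin

text \<open>With \<open>a > 1\<close> a lower bound for the eigenvalues and \<open>C\<close> a bound for the defects, consecutive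
  height quotients along an orbit differ by at most \<open>C / a\<^sup>m\<close>. They therefore converge geometrically,
  and all their limits stay within \<open>C / (a - 1)\<close> of the height. Splitting off the first \<open>k\<close> maps gives
  \<open>canonical_height P (\<omega>\<omega>') = canonical_height (\<omega> P) \<omega>' / deg \<omega>\<close>, and Fubini turns this into (b), since
  \<open>nu_star\<close> has density \<open>d\<^sup>k / deg\<close> with respect to the product measure.

  Measurability and the point-mass formulas need \<open>S\<close> to be countable. A global field is countable,
  and on an irreducible variety a morphism is determined by a single tuple of forms with
  coefficients in the field that represents it on some nonempty open set.\<close>

section \<open>Countability of the set of endomorphisms\<close>

lemma countable_gen_field:
  assumes "countable A"
  shows "countable (gen_field A :: 'a::field set)"
proof -
  \<comment> \<open>One round of field operations. The union of all rounds is a subfield containing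
    \<open>A\<close>, so it contains \<open>gen_field A\<close>, and each round preserves
    countability.\<close>
  define step :: "'a set \<Rightarrow> 'a set" where
    "step B = B \<union> {0, 1} \<union> inverse ` B \<union> (\<lambda>(x, y). x - y) ` (B \<times> B) \<union> (\<lambda>(x, y). x * y) ` (B \<times> B)"
    for B
  define L where "L = (\<Union>i. (step ^^ i) A)"
  have step_mono: "(step ^^ i) A \<subseteq> (step ^^ Suc i) A" for i
    by (auto simp: step_def)
  have mono: "(step ^^ i) A \<subseteq> (step ^^ j) A" if "i \<le> j" for i j
    using lift_Suc_mono_le[of "\<lambda>i. (step ^^ i) A", OF step_mono that] .
  have "is_subfield L"
    unfolding is_subfield_def
  proof (intro conjI ballI)
    have "0 \<in> (step ^^ Suc 0) A" "1 \<in> (step ^^ Suc 0) A"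
      by (auto simp: step_def)
    then show "0 \<in> L" "1 \<in> L" unfolding L_def by blast+
  next
    fix x assume "x \<in> L"
    then obtain i where "x \<in> (step ^^ i) A" by (auto simp: L_def)
    then have "inverse x \<in> (step ^^ Suc i) A" by (auto simp: step_def)
    then show "inverse x \<in> L" unfolding L_def by blast
  next
    fix x y assume "x \<in> L" "y \<in> L"
    then obtain i j where "x \<in> (step ^^ i) A" "y \<in> (step ^^ j) A" by (auto simp: L_def)
    then have "x \<in> (step ^^ max i j) A" "y \<in> (step ^^ max i j) A"
      using mono[of i "max i j"] mono[of j "max i j"] by auto
    then have "x - y \<in> (step ^^ Suc (max i j)) A" "x * y \<in> (step ^^ Suc (max i j)) A"
      by (force simp: step_def)+
    then show "x - y \<in> L" "x * y \<in> L" unfolding L_def by blast+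
  qed
  moreover have "A \<subseteq> L"
    unfolding L_def by (metis UN_upper UNIV_I funpow_0)
  ultimately have "gen_field A \<subseteq> L"
    unfolding gen_field_def by blast
  moreover have "countable ((step ^^ i) A)" for i
    by (induction i) (auto simp: step_def assms)
  then have "countable L"
    unfolding L_def by blast
  ultimately show ?thesis
    using countable_subset by blast
qed

text \<open>Finitely many coefficients in \<open>F\<close> determine an element. Cutting the
  coefficient function off outside \<open>B\<close> places it in
  \<open>B \<rightarrow>\<^sub>E F\<close>, which is countable because \<open>B\<close> is
  finite.\<close>

lemma countable_finite_extension:
  assumes "finite_extension F L" "countable F"
  shows "countable L"
proof -
  obtain B where B: "finite B" "L = {\<Sum>b\<in>B. c b * b | c. \<forall>b\<in>B. c b \<in> F}"
    using assms(1) unfolding finite_extension_def spans_over_def by blast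
  have "L \<subseteq> (\<lambda>c. \<Sum>b\<in>B. c b * b) ` (B \<rightarrow>\<^sub>E F)"
  proof
    fix x assume "x \<in> L"
    then obtain c where c: "x = (\<Sum>b\<in>B. c b * b)" "\<forall>b\<in>B. c b \<in> F"
      using B(2) by blast
    then have "x = (\<Sum>b\<in>B. restrict c B b * b)" "restrict c B \<in> B \<rightarrow>\<^sub>E F"
      by auto
    then show "x \<in> (\<lambda>c. \<Sum>b\<in>B. c b * b) ` (B \<rightarrow>\<^sub>E F)"
      by blast
  qed
  moreover have "countable (B \<rightarrow>\<^sub>E F)"
    using B(1) assms(2) by (intro countable_PiE) auto
  ultimately show ?thesis
    by (meson countable_image countable_subset)
qed

lemma global_field_countable:
  assumes "global_field TYPE('k::field)"
  shows "countable (UNIV :: 'k set)"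
proof -
  have "countable (prime_field :: 'k set)" "countable (gen_field {t :: 'k})" for t
    by (auto simp: prime_field_def intro: countable_gen_field)
  then show ?thesis
    using assms countable_finite_extension unfolding global_field_def by metis
qed

text \<open>A finitely supported function can be recovered from its graph over its support, which is
  a finite subset of the countable set \<open>A \<times> R\<close>.\<close>

lemma countable_poly_mappings:
  fixes R :: "'b::zero set"
  assumes "countable A" "countable R"
  shows "countable {F :: 'a \<Rightarrow>\<^sub>0 'b. Poly_Mapping.keys F \<subseteq> A \<and> (\<forall>m. Poly_Mapping.lookup F m \<in> R)}"
    (is "countable ?M")
proof (rule countable_image_inj_on)
  let ?g = "\<lambda>F :: 'a \<Rightarrow>\<^sub>0 'b. (\<lambda>m. (m, Poly_Mapping.lookup F m)) ` Poly_Mapping.keys F"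
  have "?g ` ?M \<subseteq> {T. finite T \<and> T \<subseteq> A \<times> R}" by auto
  moreover have "countable {T. finite T \<and> T \<subseteq> A \<times> R}"
    using assms by (intro countable_Collect_finite_subset) auto
  ultimately show "countable (?g ` ?M)"
    by (rule countable_subset)
  show "inj_on ?g ?M"
  proof (rule inj_onI, rule poly_mapping_eqI)
    have *: "Poly_Mapping.lookup F m = Poly_Mapping.lookup G m"
      if "?g F = ?g G" "m \<in> Poly_Mapping.keys F" for F G m
    proof -
      have "(m, Poly_Mapping.lookup F m) \<in> ?g G"
        using that(2) unfolding that(1)[symmetric] by blast
      then show ?thesis by auto
    qed
    fix F G m assume "?g F = ?g G"
    then show "Poly_Mapping.lookup F m = Poly_Mapping.lookup G m"
      using *[of F G m] *[of G F m] by (metis in_keys_iff)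
  qed
qed

section \<open>Evaluation of polynomials\<close>

lemma poly_mapping_sum_single:
  "F = (\<Sum>m\<in>Poly_Mapping.keys F. Poly_Mapping.single m (Poly_Mapping.lookup F m))"
  by (rule poly_mapping_eqI)
    (auto simp: lookup_sum lookup_single when_def in_keys_iff)

text \<open>Supports differ between summands and may shrink by cancellation, so products and sums
  are compared over a common finite index set. The extra factors here have exponent 0.\<close>

lemma prod_pow_keys_superset:
  fixes x :: "nat \<Rightarrow> 'a::field"
  assumes "finite A" "Poly_Mapping.keys m \<subseteq> A"
  shows "(\<Prod>i\<in>Poly_Mapping.keys m. x i ^ Poly_Mapping.lookup m i) = (\<Prod>i\<in>A. x i ^ Poly_Mapping.lookup m i)"
  using assms by (intro prod.mono_neutral_left) (auto simp: in_keys_iff)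

lemma mp_eval_superset:
  assumes "finite A" "Poly_Mapping.keys F \<subseteq> A"
  shows "mp_eval x F = (\<Sum>m\<in>A. Poly_Mapping.lookup F m *
     (\<Prod>i\<in>Poly_Mapping.keys m. x i ^ Poly_Mapping.lookup m i))"
  unfolding mp_eval_def using assms by (intro sum.mono_neutral_left) (auto simp: in_keys_iff)

lemma mp_eval_0 [simp]: "mp_eval x 0 = 0"
  by (simp add: mp_eval_def)

lemma mp_eval_add: "mp_eval x (F + G) = mp_eval x F + mp_eval x G"
proof -
  let ?A = "Poly_Mapping.keys F \<union> Poly_Mapping.keys G"
  have "mp_eval x H = (\<Sum>m\<in>?A. Poly_Mapping.lookup H m *
     (\<Prod>i\<in>Poly_Mapping.keys m. x i ^ Poly_Mapping.lookup m i))" if "H \<in> {F, G, F + G}" for H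
    using that keys_add[of F G] by (intro mp_eval_superset) auto
  then show ?thesis
    by (simp add: lookup_add sum.distrib ring_distribs)
qed

lemma mp_eval_diff: "mp_eval x (F - G) = mp_eval x F - mp_eval x G"
  using mp_eval_add[of x "F - G" G] by simp

lemma mp_eval_sum: "mp_eval x (\<Sum>i\<in>I. f i) = (\<Sum>i\<in>I. mp_eval x (f i))"
  by (induction I rule: infinite_finite_induct) (auto simp: mp_eval_add)

lemma mp_eval_single:
  "mp_eval x (Poly_Mapping.single m c) = c * (\<Prod>i\<in>Poly_Mapping.keys m. x i ^ Poly_Mapping.lookup m i)"
  by (simp add: mp_eval_def)

lemma mp_eval_single_mult:
  "mp_eval x (Poly_Mapping.single m c * Poly_Mapping.single m' c')
     = mp_eval x (Poly_Mapping.single m c) * mp_eval x (Poly_Mapping.single m' c')"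
proof -
  let ?A = "Poly_Mapping.keys m \<union> Poly_Mapping.keys m'"
  have *: "(\<Prod>i\<in>Poly_Mapping.keys k. x i ^ Poly_Mapping.lookup k i) = (\<Prod>i\<in>?A. x i ^ Poly_Mapping.lookup k i)"
    if "k \<in> {m, m', m + m'}" for k
    using that keys_add[of m m'] by (intro prod_pow_keys_superset) auto
  show ?thesis
    using *[of m] *[of m'] *[of "m + m'"]
    by (simp add: mult_single mp_eval_single lookup_add power_add prod.distrib mult_ac)
qed

lemma mp_eval_mult: "mp_eval x (F * G) = mp_eval x F * mp_eval x G"
proof -
  define f where "f H m = Poly_Mapping.single m (Poly_Mapping.lookup H m)" for H :: "'a mpoly" and m
  let ?F = "\<Sum>m\<in>Poly_Mapping.keys F. f F m" and ?G = "\<Sum>m\<in>Poly_Mapping.keys G. f G m"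
  \<comment> \<open>Expanding both factors into monomials reduces multiplicativity to
    \<open>mp_eval_single_mult\<close> by bilinearity.\<close>
  have FG: "F = ?F" "G = ?G"
    unfolding f_def by (rule poly_mapping_sum_single)+
  have "mp_eval x (?F * ?G) = mp_eval x ?F * mp_eval x ?G"
    by (simp add: sum_product mp_eval_sum f_def mp_eval_single_mult)
  then show ?thesis
    using FG by argo
qed

lemma mpolys_mult:
  assumes "F \<in> mpolys n UNIV" "G \<in> mpolys n UNIV"
  shows "F * G \<in> mpolys n UNIV"
proof -
  have "Poly_Mapping.keys m \<subseteq> {..n}" if m: "m \<in> Poly_Mapping.keys (F * G)" for m
  proof -
    obtain a b where "m = a + b" "a \<in> Poly_Mapping.keys F" "b \<in> Poly_Mapping.keys G"
      using keys_mult[of F G] m by blast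
    then show ?thesis
      using assms keys_add[of a b] unfolding mpolys_def by blast
  qed
  then show ?thesis by (simp add: mpolys_def)
qed

lemma mpolys_diff:
  assumes "F \<in> mpolys n UNIV" "G \<in> mpolys n UNIV"
  shows "F - G \<in> mpolys n UNIV"
  using assms keys_diff[of F G] unfolding mpolys_def by blast

lemma homs_subset_mpolys: "homs n R d \<subseteq> mpolys n UNIV"
  by (auto simp: homs_def mpolys_def)

lemma countable_mpolys:
  assumes "countable R"
  shows "countable (mpolys n R)"
proof -
  \<comment> \<open>\<open>countable_poly_mappings\<close> is used twice: first for the exponent
    vectors, then for the polynomials supported on them.\<close>
  have "countable {F :: nat \<Rightarrow>\<^sub>0 nat. Poly_Mapping.keys F \<subseteq> UNIV \<and> (\<forall>m. Poly_Mapping.lookup F m \<in> UNIV)}"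
    by (intro countable_poly_mappings) auto
  then have "countable (UNIV :: (nat \<Rightarrow>\<^sub>0 nat) set)" by simp
  from countable_poly_mappings[OF this assms] show ?thesis
    by (rule countable_subset[rotated]) (auto simp: mpolys_def)
qed

section \<open>Density of open sets in an irreducible variety\<close>

text \<open>Algebraic form of density: the points of \<open>V\<close> where \<open>f\<close> does
  not vanish form a nonempty set inside \<open>W\<close>. Primality of the vanishing ideal then
  replaces topological arguments.\<close>

definition contains_principal_open :: "nat \<Rightarrow> 'a::field ppoint set \<Rightarrow> 'a ppoint set \<Rightarrow> bool" where
  "contains_principal_open n V W \<longleftrightarrow>
     (\<exists>f\<in>mpolys n UNIV - van_ideal n V. \<forall>q\<in>V - W. vanishes_at f q)"

text \<open>The point \<open>p\<close> lies off the closed complement of \<open>W\<close>, so one of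
  the forms cutting out that complement is nonzero at \<open>p\<close>; this form is the
  witness.\<close>

lemma contains_principal_open_if_open:
  assumes "V \<subseteq> proj_space n" "open_in_var n V W" "p \<in> W"
  shows "contains_principal_open n V W"
proof -
  obtain T where T: "T \<subseteq> (\<Union>d. homs n UNIV d)" "W = V - zero_locus n T"
    using assms(2) unfolding open_in_var_def proj_closed_def by blast
  then obtain f where f: "f \<in> T" "\<not> vanishes_at f p"
    using assms by (auto simp: zero_locus_def)
  have "f \<in> mpolys n UNIV"
    using T(1) f(1) homs_subset_mpolys by blast
  moreover have "f \<notin> van_ideal n V"
    using f(2) assms(3) T(2) by (auto simp: van_ideal_def)
  moreover have "vanishes_at f q" if "q \<in> V - W" for q
    using that T(2) f(1) by (auto simp: zero_locus_def)
  ultimately show ?thesis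
    unfolding contains_principal_open_def by blast
qed

text \<open>The product of the two witnesses works: it vanishes wherever either factor does, and it
  stays outside the ideal because the ideal is prime.\<close>

lemma contains_principal_open_Int:
  assumes "irreducible_closed n V" "contains_principal_open n V W" "contains_principal_open n V W'"
  shows "contains_principal_open n V (W \<inter> W')"
proof -
  obtain f where f: "f \<in> mpolys n UNIV" "f \<notin> van_ideal n V" "\<forall>q\<in>V - W. vanishes_at f q"
    using assms(2) unfolding contains_principal_open_def by blast
  obtain g where g: "g \<in> mpolys n UNIV" "g \<notin> van_ideal n V" "\<forall>q\<in>V - W'. vanishes_at g q"
    using assms(3) unfolding contains_principal_open_def by blast
  have "f * g \<notin> van_ideal n V"
    using assms(1) f g unfolding irreducible_closed_def by blast
  moreover have "vanishes_at (f * g) q" if "q \<in> V - W \<inter> W'" for q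
    using that f(3) g(3) by (auto simp: vanishes_at_def mp_eval_mult)
  ultimately show ?thesis
    using mpolys_mult[OF f(1) g(1)] unfolding contains_principal_open_def by blast
qed

text \<open>Identity principle. With \<open>f\<close> the witness for \<open>W\<close>, the product
  \<open>f * g\<close> vanishes on \<open>W\<close> because of \<open>g\<close> and off
  \<open>W\<close> because of \<open>f\<close>; primality then cancels \<open>f\<close>.\<close>

lemma van_ideal_if_vanishes_on_open:
  assumes "irreducible_closed n V" "contains_principal_open n V W" "g \<in> mpolys n UNIV"
    "\<And>q. q \<in> V \<inter> W \<Longrightarrow> vanishes_at g q"
  shows "g \<in> van_ideal n V"
proof -
  obtain f where f: "f \<in> mpolys n UNIV" "f \<notin> van_ideal n V" "\<forall>q\<in>V - W. vanishes_at f q"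
    using assms(2) unfolding contains_principal_open_def by blast
  have "vanishes_at (f * g) q" if "q \<in> V" for q
    using f(3) assms(4)[of q] that by (auto simp: vanishes_at_def mp_eval_mult)
  then have "f * g \<in> van_ideal n V"
    using mpolys_mult[OF f(1) assms(3)] by (simp add: van_ideal_def)
  then show ?thesis
    using assms(1,3) f(1,2) unfolding irreducible_closed_def by blast
qed

lemma irreducible_closed_subset_proj_space:
  "irreducible_closed n V \<Longrightarrow> V \<subseteq> proj_space n"
  by (auto simp: irreducible_closed_def proj_closed_def zero_locus_def)

section \<open>Equality of projective points and of morphisms\<close>

text \<open>Together with \<open>pline_eqI\<close> this turns equality of points into the vanishing
  of 2 by 2 minors, a polynomial condition to which the identity principle applies.\<close>

lemma pline_eqD:
  assumes "pline u = pline v"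
  shows "u i * v j = u j * v i"
proof -
  have "u \<in> pline u"
    unfolding pline_def by (rule CollectI, rule exI[of _ 1]) auto
  then obtain c where "u = (\<lambda>i. c * v i)"
    using assms unfolding pline_def by blast
  then show ?thesis
    by (simp add: mult_ac)
qed

lemma pline_eqI:
  assumes "\<And>i j. u i * v j = u j * v i" "u i \<noteq> (0::'a::field)" "v j \<noteq> 0"
  shows "pline u = pline v"
proof -
  \<comment> \<open>If \<open>v i\<close> were zero, the minor at \<open>i\<close> and
    \<open>j\<close> would force \<open>u i * v j = 0\<close>. Hence \<open>u i / v i\<close> is
    available as the scalar carrying \<open>v\<close> to \<open>u\<close>.\<close>
  have "v i \<noteq> 0" using assms(1)[of i j] assms(2,3) by auto
  define c where "c = u i / v i"
  have u: "u k = c * v k" for k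
    using assms(1)[of k i] \<open>v i \<noteq> 0\<close> by (simp add: c_def field_simps)
  have "c \<noteq> 0" using \<open>v i \<noteq> 0\<close> assms(2) by (simp add: c_def)
  show ?thesis
    unfolding pline_def u
  proof (intro antisym subsetI)
    fix w assume "w \<in> {\<lambda>i. d * (c * v i) |d. d \<noteq> 0}"
    then obtain d where "w = (\<lambda>i. (d * c) * v i)" "d \<noteq> 0" by (auto simp: mult_ac)
    then show "w \<in> {\<lambda>i. d * v i |d. d \<noteq> 0}" using \<open>c \<noteq> 0\<close> mult_eq_0_iff by blast
  next
    fix w assume "w \<in> {\<lambda>i. d * v i |d. d \<noteq> 0}"
    then obtain d where "w = (\<lambda>i. (d / c) * (c * v i))" "d \<noteq> 0" using \<open>c \<noteq> 0\<close> by auto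
    then show "w \<in> {\<lambda>i. d * (c * v i) |d. d \<noteq> 0}" using \<open>c \<noteq> 0\<close> divide_eq_0_iff by blast
  qed
qed

text \<open>Keeps the tuple of polynomials over \<open>k\<close> from the local description in
  \<open>endomorphism_over\<close>, so that a map can be encoded by an element of a countable
  set.\<close>

definition given_by_forms_on ::
  "nat \<Rightarrow> 'a::field set \<Rightarrow> 'a ppoint set \<Rightarrow> (nat \<Rightarrow> 'a mpoly) \<Rightarrow> ('a ppoint \<Rightarrow> 'a ppoint) \<Rightarrow> bool" where
  "given_by_forms_on n k W F \<phi> \<longleftrightarrow> (\<forall>i\<le>n. F i \<in> mpolys n k) \<and>
     (\<forall>q\<in>W. \<forall>x\<in>q. (\<exists>i\<le>n. mp_eval x (F i) \<noteq> 0) \<and>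
        \<phi> q = pline (\<lambda>i. if i \<le> n then mp_eval x (F i) else 0))"

lemma endomorphism_over_local_forms:
  assumes "endomorphism_over n k V \<phi>" "p \<in> V"
  shows "\<exists>W F. open_in_var n V W \<and> p \<in> W \<and> given_by_forms_on n k W F \<phi>"
proof -
  from assms have "\<exists>W d F. open_in_var n V W \<and> p \<in> W \<and> (\<forall>i\<le>n. F i \<in> homs n k d) \<and>
      (\<forall>q\<in>W. \<forall>x\<in>q. (\<exists>i\<le>n. mp_eval x (F i) \<noteq> 0) \<and>
         \<phi> q = pline (\<lambda>i. if i \<le> n then mp_eval x (F i) else 0))"
    unfolding endomorphism_over_def by (elim conjE) (rule bspec)
  then obtain W d F where W: "open_in_var n V W" "p \<in> W" and F: "\<forall>i\<le>n. F i \<in> homs n k d"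
    and "\<forall>q\<in>W. \<forall>x\<in>q. (\<exists>i\<le>n. mp_eval x (F i) \<noteq> 0) \<and>
         \<phi> q = pline (\<lambda>i. if i \<le> n then mp_eval x (F i) else 0)"
    by (elim exE conjE)
  then have "given_by_forms_on n k W F \<phi>"
    unfolding given_by_forms_on_def homs_def by simp
  with W show ?thesis by (intro exI conjI)
qed

text \<open>The \<open>2 \<times> 2\<close> minors of the forms that define the two maps near a point vanish on a dense open
  set, hence lie in the ideal of \<open>V\<close>.\<close>

lemma endomorphism_eqI:
  assumes irr: "irreducible_closed n V"
    and endo: "endomorphism_over n k V \<phi>" "endomorphism_over n k V \<psi>"
    and W: "contains_principal_open n V W" "\<And>q. q \<in> W \<Longrightarrow> \<phi> q = \<psi> q"
  shows "\<phi> = \<psi>"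
proof (rule extensionalityI[of _ V])
  show "\<phi> \<in> extensional V" "\<psi> \<in> extensional V"
    using endo by (auto simp: endomorphism_over_def PiE_def)
  fix q assume "q \<in> V"
  obtain U G where U: "open_in_var n V U" "q \<in> U" "given_by_forms_on n k U G \<phi>"
    using endomorphism_over_local_forms[OF endo(1) \<open>q \<in> V\<close>] by (elim exE conjE)
  obtain U' G' where U': "open_in_var n V U'" "q \<in> U'" "given_by_forms_on n k U' G' \<psi>"
    using endomorphism_over_local_forms[OF endo(2) \<open>q \<in> V\<close>] by (elim exE conjE)
  \<comment> \<open>Padding by zero above \<open>n\<close> makes both sides of the minor identity
    zero when an index exceeds \<open>n\<close>; only \<open>i, j \<le> n\<close> require the
    ideal.\<close>
  define vec where "vec H x i = (if i \<le> n then mp_eval x (H i) else 0)" for H :: "nat \<Rightarrow> 'a mpoly" and x i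
  have VP: "V \<subseteq> proj_space n"
    using irreducible_closed_subset_proj_space[OF irr] .
  have dense: "contains_principal_open n V (W \<inter> (U \<inter> U'))"
    using irr W(1) contains_principal_open_if_open[OF VP U(1,2)] contains_principal_open_if_open[OF VP U'(1,2)]
    by (intro contains_principal_open_Int)
  have eq: "\<phi> z = pline (vec G x)" "\<exists>i. vec G x i \<noteq> 0" if "z \<in> U" "x \<in> z" for z x
    using that U(3) unfolding given_by_forms_on_def vec_def[abs_def] by (simp_all, metis)
  have eq': "\<psi> z = pline (vec G' x)" "\<exists>i. vec G' x i \<noteq> 0" if "z \<in> U'" "x \<in> z" for z x
    using that U'(3) unfolding given_by_forms_on_def vec_def[abs_def] by (simp_all, metis)
  obtain x where x: "x \<in> q"
    using \<open>q \<in> V\<close> VP by (force simp: proj_space_def pline_def)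
  have "vec G x i * vec G' x j = vec G x j * vec G' x i" for i j
  proof (cases "i \<le> n \<and> j \<le> n")
    case True
    have "G i * G' j - G j * G' i \<in> van_ideal n V"
    proof (rule van_ideal_if_vanishes_on_open[OF irr dense])
      have "G l \<in> mpolys n UNIV" "G' l \<in> mpolys n UNIV" if "l \<le> n" for l
        using that U(3) U'(3) by (auto simp: given_by_forms_on_def mpolys_def)
      then show "G i * G' j - G j * G' i \<in> mpolys n UNIV"
        using True by (intro mpolys_diff mpolys_mult) auto
      fix z assume z: "z \<in> V \<inter> (W \<inter> (U \<inter> U'))"
      have "vec G y i * vec G' y j = vec G y j * vec G' y i" if "y \<in> z" for y
        using z that eq(1) eq'(1) W(2) by (intro pline_eqD) force
      then show "vanishes_at (G i * G' j - G j * G' i) z"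
        using True by (simp add: vanishes_at_def mp_eval_diff mp_eval_mult vec_def)
    qed
    then show ?thesis
      using True x \<open>q \<in> V\<close>
      by (simp add: van_ideal_def vanishes_at_def mp_eval_diff mp_eval_mult vec_def)
  qed (auto simp: vec_def)
  then show "\<phi> q = \<psi> q"
    using eq[OF U(2) x] eq'[OF U'(2) x] pline_eqI[of "vec G x" "vec G' x"] by auto
qed

text \<open>Each map is encoded by chosen forms representing it near one fixed point
  \<open>p\<close>. Equal tuples make two maps agree on the intersection of two dense
  neighbourhoods, hence everywhere by \<open>endomorphism_eqI\<close>.\<close>

lemma countable_endomorphisms:
  assumes irr: "irreducible_closed n V" and "countable k"
  shows "countable {\<phi>. endomorphism_over n k V \<phi>}" (is "countable ?E")
proof -
  have VP: "V \<subseteq> proj_space n"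
    using irreducible_closed_subset_proj_space[OF irr] .
  obtain p where p: "p \<in> V"
    using irr by (auto simp: irreducible_closed_def)
  have "\<forall>\<phi>\<in>?E. \<exists>W F. open_in_var n V W \<and> p \<in> W \<and> given_by_forms_on n k W F \<phi>"
    using endomorphism_over_local_forms p by blast
  then obtain W F where WF: "\<And>\<phi>. \<phi> \<in> ?E \<Longrightarrow> open_in_var n V (W \<phi>)" "\<And>\<phi>. \<phi> \<in> ?E \<Longrightarrow> p \<in> W \<phi>"
      "\<And>\<phi>. \<phi> \<in> ?E \<Longrightarrow> given_by_forms_on n k (W \<phi>) (F \<phi>) \<phi>"
    unfolding bchoice_iff by blast
  have dense: "contains_principal_open n V (W \<phi>)" if "\<phi> \<in> ?E" for \<phi>
    using contains_principal_open_if_open[OF VP] WF(1,2) that by blast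
  show ?thesis
  proof (rule countable_image_inj_on)
    let ?g = "\<lambda>\<phi>. restrict (F \<phi>) {..n}"
    have "?g ` ?E \<subseteq> {..n} \<rightarrow>\<^sub>E mpolys n k"
      using WF(3) unfolding given_by_forms_on_def by (intro image_subsetI restrict_PiE) auto
    moreover have "countable ({..n} \<rightarrow>\<^sub>E mpolys n k)"
      using countable_mpolys[OF assms(2)] by (intro countable_PiE) auto
    ultimately show "countable (?g ` ?E)"
      by (rule countable_subset)
    show "inj_on ?g ?E"
    proof (rule inj_onI)
      fix \<phi> \<psi> assume E: "\<phi> \<in> ?E" "\<psi> \<in> ?E" and "?g \<phi> = ?g \<psi>"
      then have F: "F \<phi> i = F \<psi> i" if "i \<le> n" for i
        using that by (metis atMost_iff restrict_apply')
      show "\<phi> = \<psi>"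
      proof (rule endomorphism_eqI[OF irr])
        \<comment> \<open>Intersecting with \<open>V\<close> ensures that every \<open>q\<close>
          considered has a coordinate vector at which the forms can be evaluated.\<close>
        show "contains_principal_open n V (W \<phi> \<inter> W \<psi> \<inter> V)"
          using contains_principal_open_Int[OF irr dense[OF E(1)] dense[OF E(2)]]
          unfolding contains_principal_open_def by blast
        fix q assume q: "q \<in> W \<phi> \<inter> W \<psi> \<inter> V"
        obtain x where "x \<in> q"
          using q VP by (force simp: proj_space_def pline_def)
        then have "\<phi> q = pline (\<lambda>i. if i \<le> n then mp_eval x (F \<phi> i) else 0)"
          "\<psi> q = pline (\<lambda>i. if i \<le> n then mp_eval x (F \<psi> i) else 0)"
          using q WF(3)[OF E(1)] WF(3)[OF E(2)] by (auto simp: given_by_forms_on_def)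
        then show "\<phi> q = \<psi> q"
          using F by (simp cong: if_cong)
      qed (use E in auto)
    qed
  qed
qed

lemma countable_endomorphisms_base_field:
  assumes "global_field TYPE('k::field)" "irreducible_closed n V"
  shows "countable {\<phi>. endomorphism_over n (base_field :: 'k alg_closure set) V \<phi>}"
  using assms global_field_countable by (auto simp: base_field_def intro: countable_endomorphisms)

section \<open>Canonical heights of random orbits\<close>

text \<open>Countability lets point masses determine the measure. This connects integrals with the
  series in \<open>d_const\<close> and the point measure in \<open>nu_star\<close>.\<close>

lemma measure_eq_density_count_space:
  assumes "countable (space M)" "sets M = Pow (space M)"
  shows "M = density (count_space (space M)) (\<lambda>x. emeasure M {x})"
proof (rule measure_eqI_countable[of _ "space M"])
  show "sets (density (count_space (space M)) (\<lambda>x. emeasure M {x})) = Pow (space M)" by simp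
  fix x assume "x \<in> space M"
  then show "emeasure M {x} = emeasure (density (count_space (space M)) (\<lambda>x. emeasure M {x})) {x}"
    by (simp add: emeasure_density nn_integral_count_space_indicator[symmetric] nn_integral_indicator_singleton')
qed (use assms in auto)

text \<open>For finite \<open>I\<close> a singleton is a box of singletons, and every subset is a
  countable union of these. Hence every real function on a finite product is measurable.\<close>

lemma sets_PiM_countable_discrete:
  assumes "finite I" "countable (space M)" "sets M = Pow (space M)"
  shows "sets (PiM I (\<lambda>_. M)) = Pow (I \<rightarrow>\<^sub>E space M)"
proof (intro antisym subsetI)
  fix A assume "A \<in> sets (PiM I (\<lambda>_. M))"
  then show "A \<in> Pow (I \<rightarrow>\<^sub>E space M)"
    using sets.sets_into_space by (fastforce simp: space_PiM)
next
  fix A assume A: "A \<in> Pow (I \<rightarrow>\<^sub>E space M)"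
  have "{x} \<in> sets (PiM I (\<lambda>_. M))" if "x \<in> A" for x
  proof -
    have x: "x \<in> I \<rightarrow>\<^sub>E space M" using A that by blast
    then have "Pi\<^sub>E I (\<lambda>i. {x i}) \<in> sets (PiM I (\<lambda>_. M))"
      using assms by (intro sets_PiM_I_finite) auto
    moreover have "Pi\<^sub>E I (\<lambda>i. {x i}) = {x}"
      using x by (intro PiE_singleton) (auto simp: PiE_def)
    ultimately show ?thesis by simp
  qed
  moreover have "countable A"
    using A assms countable_PiE[of I "\<lambda>_. space M"] countable_subset by blast
  ultimately have "(\<Union>x\<in>A. {x}) \<in> sets (PiM I (\<lambda>_. M))"
    by (intro sets.countable_UN') auto
  then show "A \<in> sets (PiM I (\<lambda>_. M))" by simp
qed

section \<open>Orbits along concatenated sequences\<close>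

lemma act_cong: "(\<And>i. i < m \<Longrightarrow> \<gamma> i = \<gamma>' i) \<Longrightarrow> act \<gamma> m P = act \<gamma>' m P"
  by (induction m) auto

lemma seq_deg_cong: "(\<And>i. i < m \<Longrightarrow> \<gamma> i = \<gamma>' i) \<Longrightarrow> seq_deg \<alpha> \<gamma> m = seq_deg \<alpha> \<gamma>' m"
  by (simp add: seq_deg_def)

lemma height_quotient_cong:
  "(\<And>i. i < m \<Longrightarrow> \<gamma> i = \<gamma>' i) \<Longrightarrow> height_quotient h \<alpha> P \<gamma> m = height_quotient h \<alpha> P \<gamma>' m"
  unfolding height_quotient_def using act_cong[of m \<gamma> \<gamma>'] seq_deg_cong[of m \<gamma> \<gamma>'] by metis

lemma act_comb_seq: "act (comb_seq k \<omega> \<omega>') (m + k) P = act \<omega>' m (act \<omega> k P)"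
proof (induction m)
  case 0
  then show ?case by (auto simp: comb_seq_less intro: act_cong)
qed (simp add: comb_seq_add)

lemma seq_deg_comb_seq:
  "seq_deg \<alpha> (comb_seq k \<omega> \<omega>') (m + k) = seq_deg \<alpha> \<omega> k * seq_deg \<alpha> \<omega>' m"
proof (induction m)
  case 0
  have "seq_deg \<alpha> (comb_seq k \<omega> \<omega>') k = seq_deg \<alpha> \<omega> k"
    by (rule seq_deg_cong) (simp add: comb_seq_less)
  then show ?case by (simp add: seq_deg_def)
qed (simp add: seq_deg_def comb_seq_add)

text \<open>The first \<open>k\<close> steps follow \<open>\<omega>\<close> and the next
  \<open>m\<close> follow \<open>\<omega>'\<close>. Both the orbit and the degree split at time
  \<open>k\<close>; the limit in \<open>m\<close> is the source of (b).\<close>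

lemma height_quotient_comb_seq:
  "height_quotient h \<alpha> P (comb_seq k \<omega> \<omega>') (m + k)
     = height_quotient h \<alpha> (act \<omega> k P) \<omega>' m / seq_deg \<alpha> \<omega> k"
  by (simp add: height_quotient_def act_comb_seq seq_deg_comb_seq)

section \<open>Uniform convergence of height quotients\<close>

text \<open>Abstracts height control to two real constants. Inside the locale \<open>S\<close> is
  the product measure on infinite sequences supplied by \<open>sequence_space\<close>, while the set
  of maps is \<open>space M\<close>.\<close>

locale random_orbit_heights = sequence_space M
  for M :: "('p \<Rightarrow> 'p) measure" +
  fixes V :: "'p set" and h :: "'p \<Rightarrow> real" and \<alpha> :: "('p \<Rightarrow> 'p) \<Rightarrow> real" and a C :: real
  assumes countable_space: "countable (space M)"
    and sets_M: "sets M = Pow (space M)"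
    and maps_into: "\<phi> \<in> space M \<Longrightarrow> P \<in> V \<Longrightarrow> \<phi> P \<in> V"
    and a_gt_1: "1 < a"
    and \<alpha>_ge: "\<phi> \<in> space M \<Longrightarrow> a \<le> \<alpha> \<phi>"
    and defect_le: "\<phi> \<in> space M \<Longrightarrow> P \<in> V \<Longrightarrow> \<bar>h (\<phi> P) - \<alpha> \<phi> * h P\<bar> \<le> C"
begin

lemma space_S: "\<omega> \<in> space S \<Longrightarrow> \<omega> i \<in> space M"
  by (auto simp: space_PiM PiE_def)

lemma act_in: "(\<And>i. i < m \<Longrightarrow> \<gamma> i \<in> space M) \<Longrightarrow> P \<in> V \<Longrightarrow> act \<gamma> m P \<in> V"
  by (induction m) (auto intro: maps_into)

lemma seq_deg_ge: "(\<And>i. i < m \<Longrightarrow> \<gamma> i \<in> space M) \<Longrightarrow> a ^ m \<le> seq_deg \<alpha> \<gamma> m"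
  unfolding seq_deg_def using a_gt_1 \<alpha>_ge prod_mono[of "{..<m}" "\<lambda>_. a" "\<lambda>i. \<alpha> (\<gamma> i)"] by auto

lemma seq_deg_ge_1:
  assumes "\<And>i. i < m \<Longrightarrow> \<gamma> i \<in> space M"
  shows "1 \<le> seq_deg \<alpha> \<gamma> m"
  using seq_deg_ge[of m \<gamma>, OF assms] a_gt_1 one_le_power[of a m] by linarith

lemma height_quotient_step:
  assumes "\<gamma> \<in> space S" "P \<in> V"
  shows "\<bar>height_quotient h \<alpha> P \<gamma> (Suc m) - height_quotient h \<alpha> P \<gamma> m\<bar> \<le> C * (1 / a) ^ Suc m"
proof -
  let ?Q = "act \<gamma> m P" and ?D = "seq_deg \<alpha> \<gamma> (Suc m)"
  have pos: "0 < \<alpha> (\<gamma> m)" "1 \<le> seq_deg \<alpha> \<gamma> m" "a ^ Suc m \<le> ?D"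
    using space_S[OF assms(1)] \<alpha>_ge[of "\<gamma> m"] a_gt_1 seq_deg_ge_1[of m \<gamma>] seq_deg_ge[of "Suc m" \<gamma>] by auto
  have le: "\<bar>h (\<gamma> m ?Q) - \<alpha> (\<gamma> m) * h ?Q\<bar> \<le> C"
    using space_S[OF assms(1)] assms(2) by (intro defect_le act_in)
  \<comment> \<open>The degree at \<open>Suc m\<close> is the degree at \<open>m\<close> times
    \<open>\<alpha> (\<gamma> m)\<close>, so over the common denominator \<open>?D\<close> the
    numerator is exactly the defect of \<open>\<gamma> m\<close> at \<open>?Q\<close>.\<close>
  have "height_quotient h \<alpha> P \<gamma> (Suc m) - height_quotient h \<alpha> P \<gamma> m = (h (\<gamma> m ?Q) - \<alpha> (\<gamma> m) * h ?Q) / ?D"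
    using pos(1,2) by (simp add: height_quotient_def seq_deg_def diff_divide_distrib)
  also have "\<bar>\<dots>\<bar> \<le> C / a ^ Suc m"
    using le pos a_gt_1 unfolding abs_divide by (intro frac_le) auto
  finally show ?thesis by (simp add: power_divide)
qed

text \<open>The exponents start at 1, since the step from time 0 already divides by one eigenvalue;
  hence the total is \<open>C / (a - 1)\<close>.\<close>

lemma geometric_bound_sums: "(\<lambda>i. C * (1 / a) ^ Suc i) sums (C / (a - 1))"
proof -
  have "(\<lambda>i. C / a * (1 / a) ^ i) sums (C / a * (1 / (1 - 1 / a)))"
    using a_gt_1 by (intro sums_mult geometric_sums) auto
  moreover have "C / a * (1 / (1 - 1 / a)) = C / (a - 1)"
    using a_gt_1 by (simp add: field_simps)
  moreover have "(\<lambda>i. C / a * (1 / a) ^ i) = (\<lambda>i. C * (1 / a) ^ Suc i)"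
    by simp
  ultimately show ?thesis
    by (simp only:)
qed

lemma height_quotient_bound:
  assumes "\<gamma> \<in> space S" "P \<in> V"
  shows "\<bar>height_quotient h \<alpha> P \<gamma> m - h P\<bar> \<le> C / (a - 1)"
proof -
  let ?f = "height_quotient h \<alpha> P \<gamma>"
  \<comment> \<open>\<open>C\<close> bounds an absolute value, that of the defect of the first map
    at \<open>P\<close>. Nonnegativity lets the full series dominate its partial sums.\<close>
  have C: "0 \<le> C" using defect_le[OF space_S[OF assms(1), of 0] assms(2)] by linarith
  \<comment> \<open>Telescoping starts at \<open>h P\<close>, the quotient at time 0, where the
    degree is an empty product.\<close>
  have "?f m - h P = (\<Sum>i<m. ?f (Suc i) - ?f i)"
    by (simp add: sum_lessThan_telescope) (simp add: height_quotient_def seq_deg_def)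
  also have "\<bar>\<dots>\<bar> \<le> (\<Sum>i<m. C * (1 / a) ^ Suc i)"
    using height_quotient_step[OF assms] by (intro order_trans[OF sum_abs] sum_mono) auto
  also have "\<dots> \<le> C / (a - 1)"
    using a_gt_1 C by (intro sum_le_suminf[OF sums_summable[OF geometric_bound_sums], folded sums_unique[OF geometric_bound_sums]]) auto
  finally show ?thesis .
qed

lemma height_quotient_convergent:
  assumes "\<gamma> \<in> space S" "P \<in> V"
  shows "convergent (height_quotient h \<alpha> P \<gamma>)"
proof -
  let ?f = "height_quotient h \<alpha> P \<gamma>"
  have "summable (\<lambda>i. ?f (Suc i) - ?f i)"
    by (rule summable_comparison_test'[OF sums_summable[OF geometric_bound_sums], where N = 0])
      (use height_quotient_step[OF assms] in auto)
  then have "convergent (\<lambda>m. (\<Sum>i<m. ?f (Suc i) - ?f i) + ?f 0)"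
    by (intro convergent_add convergent_const) (simp add: summable_iff_convergent)
  then show ?thesis
    by (simp add: sum_lessThan_telescope)
qed

lemma height_quotient_tendsto:
  assumes "\<gamma> \<in> space S" "P \<in> V"
  shows "height_quotient h \<alpha> P \<gamma> \<longlonglongrightarrow> canonical_height h \<alpha> P \<gamma>"
  using height_quotient_convergent[OF assms] unfolding canonical_height_def
  by (simp add: convergent_LIMSEQ_iff)

lemma canonical_height_bound:
  assumes "\<gamma> \<in> space S" "P \<in> V"
  shows "\<bar>canonical_height h \<alpha> P \<gamma> - h P\<bar> \<le> C / (a - 1)"
proof (rule LIMSEQ_le_const2)
  show "(\<lambda>m. \<bar>height_quotient h \<alpha> P \<gamma> m - h P\<bar>) \<longlonglongrightarrow> \<bar>canonical_height h \<alpha> P \<gamma> - h P\<bar>"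
    by (intro tendsto_intros height_quotient_tendsto assms)
qed (use height_quotient_bound[OF assms] in auto)

text \<open>Both sides are limits of one sequence: the quotients of the concatenation from time
  \<open>k\<close> on are those of \<open>act \<omega> k P\<close> along \<open>\<omega>'\<close>,
  divided by a constant.\<close>

lemma canonical_height_comb_seq:
  assumes "\<omega> \<in> space S" "\<omega>' \<in> space S" "P \<in> V"
  shows "canonical_height h \<alpha> P (comb_seq k \<omega> \<omega>') = canonical_height h \<alpha> (act \<omega> k P) \<omega>' / seq_deg \<alpha> \<omega> k"
proof (rule LIMSEQ_unique)
  have "height_quotient h \<alpha> P (comb_seq k \<omega> \<omega>') \<longlonglongrightarrow> canonical_height h \<alpha> P (comb_seq k \<omega> \<omega>')"
    using assms by (intro height_quotient_tendsto) (auto simp: comb_seq_def space_PiM PiE_def Pi_iff)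
  then show "(\<lambda>m. height_quotient h \<alpha> (act \<omega> k P) \<omega>' m / seq_deg \<alpha> \<omega> k)
      \<longlonglongrightarrow> canonical_height h \<alpha> P (comb_seq k \<omega> \<omega>')"
    unfolding height_quotient_comb_seq[symmetric] by (rule LIMSEQ_ignore_initial_segment)
  show "(\<lambda>m. height_quotient h \<alpha> (act \<omega> k P) \<omega>' m / seq_deg \<alpha> \<omega> k)
      \<longlonglongrightarrow> canonical_height h \<alpha> (act \<omega> k P) \<omega>' / seq_deg \<alpha> \<omega> k"
    using assms seq_deg_ge_1[of k \<omega>] space_S by (intro tendsto_intros height_quotient_tendsto act_in) auto
qed

section \<open>Measurability and the expected height\<close>

lemma borel_measurable_PiM_fin: "(f :: (nat \<Rightarrow> 'p \<Rightarrow> 'p) \<Rightarrow> real) \<in> borel_measurable (PiM {..<m} (\<lambda>_. M))"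
  using sets_PiM_countable_discrete[OF finite_lessThan countable_space sets_M, of m]
  by (auto simp: measurable_def space_PiM)

lemma restrict_measurable: "(\<lambda>\<omega>. restrict \<omega> {..<m}) \<in> measurable S (PiM {..<m} (\<lambda>_. M))"
  by (rule measurable_restrict_subset) simp

text \<open>Such a function factors through a finite product, where everything is measurable. This
  applies to height quotients and so yields measurability of their limit.\<close>

lemma borel_measurable_prefix:
  assumes "\<And>\<omega>. f (restrict \<omega> {..<m}) = f \<omega>"
  shows "(f :: (nat \<Rightarrow> 'p \<Rightarrow> 'p) \<Rightarrow> real) \<in> borel_measurable S"
  using measurable_compose[OF restrict_measurable borel_measurable_PiM_fin[where f = f], of m] assms by simp

lemma borel_measurable_canonical_height: "canonical_height h \<alpha> P \<in> borel_measurable S"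
proof -
  have "(\<lambda>\<gamma>. height_quotient h \<alpha> P \<gamma> m) \<in> borel_measurable S" for m
    by (rule borel_measurable_prefix[where m = m]) (auto intro: height_quotient_cong)
  then show ?thesis
    unfolding canonical_height_def[abs_def] by (rule borel_measurable_lim_metric)
qed

lemma canonical_height_abs_le:
  assumes "\<gamma> \<in> space S" "P \<in> V"
  shows "\<bar>canonical_height h \<alpha> P \<gamma>\<bar> \<le> \<bar>h P\<bar> + C / (a - 1)"
  using canonical_height_bound[OF assms] by linarith

lemma integrable_canonical_height:
  assumes "P \<in> V"
  shows "integrable S (canonical_height h \<alpha> P)"
  using assms canonical_height_abs_le
  by (intro P.integrable_const_bound[where B = "\<bar>h P\<bar> + C / (a - 1)"] AE_I2 borel_measurable_canonical_height) auto

lemma expected_height_eq: "expected_height M h \<alpha> P = (\<integral>\<gamma>. canonical_height h \<alpha> P \<gamma> \<partial>S)"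
  by (simp add: expected_height_def seq_measure_def)

lemma expected_height_bound:
  assumes "P \<in> V"
  shows "\<bar>expected_height M h \<alpha> P - h P\<bar> \<le> C / (a - 1)"
proof -
  have "expected_height M h \<alpha> P - h P = (\<integral>\<gamma>. canonical_height h \<alpha> P \<gamma> - h P \<partial>S)"
    using integrable_canonical_height[OF assms] by (simp add: expected_height_eq P.prob_space)
  also have "\<bar>\<dots>\<bar> \<le> (\<integral>\<gamma>. \<bar>canonical_height h \<alpha> P \<gamma> - h P\<bar> \<partial>S)"
    by (rule integral_abs_bound)
  also have "\<dots> \<le> C / (a - 1)"
    using assms integrable_canonical_height[OF assms] canonical_height_bound
    by (intro P.integral_le_const integrable_abs Bochner_Integration.integrable_diff AE_I2) auto
  finally show ?thesis .
qed

text \<open>Concatenation carries the product of two copies of \<open>S\<close> to \<open>S\<close>.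
  By Fubini, integrating over the tail first produces the expected height at the point reached after
  \<open>k\<close> steps.\<close>

lemma expected_height_recursion:
  assumes "P \<in> V"
  shows "expected_height M h \<alpha> P
    = (\<integral>\<gamma>. expected_height M h \<alpha> (act \<gamma> k P) / seq_deg \<alpha> \<gamma> k \<partial>PiM {..<k} (\<lambda>_. M))"
proof -
  interpret SS: pair_prob_space S S ..
  let ?c = "\<lambda>(\<omega>, \<omega>'). comb_seq k \<omega> \<omega>'"
  let ?F = "\<lambda>\<gamma>. expected_height M h \<alpha> (act \<gamma> k P) / seq_deg \<alpha> \<gamma> k"
  have int: "integrable (S \<Otimes>\<^sub>M S) (\<lambda>x. canonical_height h \<alpha> P (?c x))"
    using integrable_canonical_height[OF assms]
    by (subst (asm) PiM_comb_seq[of k, symmetric]) (rule integrable_distr[OF measurable_comb_seq])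
  have "expected_height M h \<alpha> P = (\<integral>x. canonical_height h \<alpha> P (?c x) \<partial>(S \<Otimes>\<^sub>M S))"
    unfolding expected_height_eq
    by (subst PiM_comb_seq[of k, symmetric], rule integral_distr)
      (auto intro: measurable_comb_seq borel_measurable_canonical_height)
  also have "\<dots> = (\<integral>\<omega>. (\<integral>\<omega>'. canonical_height h \<alpha> P (comb_seq k \<omega> \<omega>') \<partial>S) \<partial>S)"
    using SS.integral_fst'[OF int] by simp
  also have "\<dots> = (\<integral>\<omega>. ?F \<omega> \<partial>S)"
  proof (rule Bochner_Integration.integral_cong[OF refl])
    fix \<omega> assume "\<omega> \<in> space S"
    then have "(\<integral>\<omega>'. canonical_height h \<alpha> P (comb_seq k \<omega> \<omega>') \<partial>S)
      = (\<integral>\<omega>'. canonical_height h \<alpha> (act \<omega> k P) \<omega>' / seq_deg \<alpha> \<omega> k \<partial>S)"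
      using assms space_S by (intro Bochner_Integration.integral_cong canonical_height_comb_seq) auto
    then show "(\<integral>\<omega>'. canonical_height h \<alpha> P (comb_seq k \<omega> \<omega>') \<partial>S) = ?F \<omega>"
      by (simp add: expected_height_eq)
  qed
  \<comment> \<open>The integrand reads only the first \<open>k\<close> entries, so the integral
    descends to the finite product, the image of \<open>S\<close> under restriction.\<close>
  also have "\<dots> = (\<integral>\<omega>. ?F (restrict \<omega> {..<k}) \<partial>S)"
    by (intro Bochner_Integration.integral_cong arg_cong2[where f = "(/)"] arg_cong[where f = "expected_height M h \<alpha>"]
        act_cong seq_deg_cong) auto
  also have "\<dots> = (\<integral>\<gamma>. ?F \<gamma> \<partial>distr S (PiM {..<k} (\<lambda>_. M)) (\<lambda>\<omega>. restrict \<omega> {..<k}))"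
    by (rule integral_distr[symmetric]) (rule restrict_measurable borel_measurable_PiM_fin)+
  finally show ?thesis
    by (simp add: distr_PiM_restrict_finite)
qed

section \<open>The reweighted measure \<open>nu_star\<close>\<close>

lemma integrable_inverse_\<alpha>: "integrable M (\<lambda>\<phi>. 1 / \<alpha> \<phi>)"
  using a_gt_1 \<alpha>_ge sets_M
  by (intro finite_measure.integrable_const_bound[where B = 1] AE_I2)
     (force simp: measurable_def field_simps)+

lemma d_const_eq: "d_const M \<alpha> = inverse (\<integral>\<phi>. 1 / \<alpha> \<phi> \<partial>M)"
proof -
  have M: "M = density (count_space (space M)) (\<lambda>\<phi>. ennreal (measure M {\<phi>}))"
    using measure_eq_density_count_space[OF countable_space sets_M] by (simp add: M.emeasure_eq_measure)
  \<comment> \<open>Integrability against the point-mass density is absolute summability, which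
    makes the unordered sum in \<open>d_const\<close> agree with the integral.\<close>
  have "Infinite_Set_Sum.abs_summable_on (\<lambda>\<phi>. measure M {\<phi>} / \<alpha> \<phi>) (space M)"
    using integrable_inverse_\<alpha> by (subst (asm) M) (simp add: integrable_density Infinite_Set_Sum.abs_summable_on_def)
  then have "(\<Sum>\<^sub>\<infinity>\<phi>\<in>space M. measure M {\<phi>} / \<alpha> \<phi>) = (\<Sum>\<^sub>a\<phi>\<in>space M. measure M {\<phi>} / \<alpha> \<phi>)"
    by (rule infsetsum_infsum[symmetric])
  also have "\<dots> = (\<integral>\<phi>. 1 / \<alpha> \<phi> \<partial>M)"
    by (subst (2) M) (simp add: integral_density infsetsum_def)
  finally show ?thesis by (simp add: d_const_def)
qed

text \<open>A strictly positive function has strictly positive integral over a space of mass 1, so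
  the inverse in \<open>d_const\<close> is a genuine reciprocal.\<close>

lemma d_const_pos: "0 < d_const M \<alpha>"
proof -
  have "AE \<phi> in M. 0 < 1 / \<alpha> \<phi>"
    using \<alpha>_ge a_gt_1 by (intro AE_I2) fastforce
  then have "(\<integral>\<phi>. 0 \<partial>M) < (\<integral>\<phi>. 1 / \<alpha> \<phi> \<partial>M)"
    by (intro M.integral_less_AE_space integrable_inverse_\<alpha>) (auto simp: M.emeasure_space_1)
  then show ?thesis by (simp add: d_const_eq)
qed

text \<open>Both measures have the same density with respect to counting measure. In this form
  integrals against \<open>nu_star\<close> become weighted integrals over independent
  coordinates.\<close>

lemma nu_star_eq_density:
  "nu_star M \<alpha> k = density (PiM {..<k} (\<lambda>_. M)) (\<lambda>\<gamma>. ennreal (d_const M \<alpha> ^ k / seq_deg \<alpha> \<gamma> k))"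
proof -
  let ?N = "PiM {..<k} (\<lambda>_. M)" and ?A = "{..<k} \<rightarrow>\<^sub>E space M"
  interpret N: prob_space ?N
    by (rule prob_space_PiM) (rule M.prob_space_axioms)
  have "countable ?A"
    using countable_space by (intro countable_PiE) auto
  then have N: "?N = density (count_space ?A) (\<lambda>\<gamma>. ennreal (measure ?N {\<gamma>}))"
    using measure_eq_density_count_space[of ?N] sets_PiM_countable_discrete[OF _ countable_space sets_M, of "{..<k}"]
    by (simp add: space_PiM N.emeasure_eq_measure)
  have "nu_star M \<alpha> k = density (count_space ?A)
      (\<lambda>\<gamma>. ennreal (measure ?N {\<gamma>}) * ennreal (d_const M \<alpha> ^ k / seq_deg \<alpha> \<gamma> k))"
    unfolding nu_star_def point_measure_def seq_measure_fin_def
  proof (rule density_cong)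
    show "AE \<gamma> in count_space ?A. ennreal (measure ?N {\<gamma>} / seq_deg \<alpha> \<gamma> k * d_const M \<alpha> ^ k)
        = ennreal (measure ?N {\<gamma>}) * ennreal (d_const M \<alpha> ^ k / seq_deg \<alpha> \<gamma> k)"
      by (rule AE_I2) (simp add: ennreal_mult'[symmetric] mult_ac)
  qed auto
  also have "\<dots> = density (density (count_space ?A) (\<lambda>\<gamma>. ennreal (measure ?N {\<gamma>})))
      (\<lambda>\<gamma>. ennreal (d_const M \<alpha> ^ k / seq_deg \<alpha> \<gamma> k))"
    by (rule density_density_eq[symmetric]) auto
  finally show ?thesis
    using N by simp
qed

text \<open>Independence: the expectation of a product over the coordinates is the product of the
  expectations.\<close>

lemma integral_inverse_seq_deg:
  "(\<integral>\<gamma>. 1 / seq_deg \<alpha> \<gamma> k \<partial>PiM {..<k} (\<lambda>_. M)) = (\<integral>\<phi>. 1 / \<alpha> \<phi> \<partial>M) ^ k"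
proof -
  have "(\<integral>\<gamma>. (\<Prod>i<k. 1 / \<alpha> (\<gamma> i)) \<partial>PiM {..<k} (\<lambda>_. M)) = (\<Prod>i<k. \<integral>\<phi>. 1 / \<alpha> \<phi> \<partial>M)"
    by (rule product_integral_prod) (auto intro: integrable_inverse_\<alpha>)
  then show ?thesis
    by (simp add: seq_deg_def prod_dividef)
qed

lemma space_fin: "\<gamma> \<in> space (PiM {..<k} (\<lambda>_. M)) \<Longrightarrow> i < k \<Longrightarrow> \<gamma> i \<in> space M"
  by (auto simp: space_PiM PiE_def)

lemma integrable_inverse_seq_deg: "integrable (PiM {..<k} (\<lambda>_. M)) (\<lambda>\<gamma>. 1 / seq_deg \<alpha> \<gamma> k)"
proof -
  interpret N: prob_space "PiM {..<k} (\<lambda>_. M)"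
    by (rule prob_space_PiM) (rule M.prob_space_axioms)
  have "\<bar>1 / seq_deg \<alpha> \<gamma> k\<bar> \<le> 1" if "\<gamma> \<in> space (PiM {..<k} (\<lambda>_. M))" for \<gamma>
    using seq_deg_ge_1[of k \<gamma>] space_fin[OF that] by (simp add: field_simps)
  then show ?thesis
    by (intro N.integrable_const_bound[where B = 1] AE_I2 borel_measurable_PiM_fin) auto
qed

lemma nu_star_weight_nonneg:
  "\<gamma> \<in> space (PiM {..<k} (\<lambda>_. M)) \<Longrightarrow> 0 \<le> d_const M \<alpha> ^ k / seq_deg \<alpha> \<gamma> k"
  using seq_deg_ge_1[of k \<gamma>] space_fin[of \<gamma> k] d_const_pos by fastforce

text \<open>The total mass is \<open>d_const M \<alpha> ^ k\<close> times the \<open>k\<close>-th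
  power of the integral of \<open>1 / \<alpha>\<close>, and \<open>d_const\<close> is the reciprocal
  of that integral.\<close>

lemma prob_space_nu_star: "prob_space (nu_star M \<alpha> k)"
proof (rule prob_spaceI)
  let ?N = "PiM {..<k} (\<lambda>_. M)"
  have "emeasure (nu_star M \<alpha> k) (space (nu_star M \<alpha> k))
    = (\<integral>\<^sup>+\<gamma>. ennreal (d_const M \<alpha> ^ k / seq_deg \<alpha> \<gamma> k) \<partial>?N)"
    unfolding nu_star_eq_density space_density
    by (subst emeasure_density)
      (auto intro!: measurable_compose[OF borel_measurable_PiM_fin] nn_integral_cong)
  also have "\<dots> = ennreal (\<integral>\<gamma>. d_const M \<alpha> ^ k * (1 / seq_deg \<alpha> \<gamma> k) \<partial>?N)"
    using integrable_mult_right[OF integrable_inverse_seq_deg] nu_star_weight_nonneg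
    by (subst nn_integral_eq_integral[symmetric]) (auto intro!: AE_I2 simp del: integrable_mult_right_iff)
  also have "\<dots> = ennreal (d_const M \<alpha> ^ k * (\<integral>\<phi>. 1 / \<alpha> \<phi> \<partial>M) ^ k)"
    by (subst Bochner_Integration.integral_mult_right_zero) (simp only: integral_inverse_seq_deg)
  also have "\<dots> = 1"
    using d_const_pos by (simp add: d_const_eq power_mult_distrib[symmetric])
  finally show "emeasure (nu_star M \<alpha> k) (space (nu_star M \<alpha> k)) = 1" .
qed

text \<open>The degree in the denominator of the density is the one in
  \<open>expected_height_recursion\<close>, so only the factor \<open>d_const M \<alpha> ^ k\<close>
  remains.\<close>

lemma expected_height_nu_star:
  assumes "P \<in> V"
  shows "integrable (nu_star M \<alpha> k) (\<lambda>\<gamma>. expected_height M h \<alpha> (act \<gamma> k P))"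
    and "(\<integral>\<gamma>. expected_height M h \<alpha> (act \<gamma> k P) \<partial>nu_star M \<alpha> k) = d_const M \<alpha> ^ k * expected_height M h \<alpha> P"
proof -
  let ?N = "PiM {..<k} (\<lambda>_. M)"
  interpret N: prob_space ?N
    by (rule prob_space_PiM) (rule M.prob_space_axioms)
  let ?E = "\<lambda>\<gamma>. expected_height M h \<alpha> (act \<gamma> k P)" and ?w = "\<lambda>\<gamma>. d_const M \<alpha> ^ k / seq_deg \<alpha> \<gamma> k"
  have w: "AE \<gamma> in ?N. 0 \<le> ?w \<gamma>"
    using nu_star_weight_nonneg by (rule AE_I2)
  let ?B = "C / (a - 1)"
  \<comment> \<open>One \<open>?B\<close> compares \<open>h ?Q / ?D\<close> with \<open>h P\<close>;
    the other compares \<open>?E \<gamma>\<close> with \<open>h ?Q\<close> and survives division by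
    \<open>?D \<ge> 1\<close>.\<close>
  have "\<bar>?E \<gamma> / seq_deg \<alpha> \<gamma> k\<bar> \<le> \<bar>h P\<bar> + 2 * ?B" if \<gamma>: "\<gamma> \<in> space ?N" for \<gamma>
  proof -
    \<comment> \<open>\<open>\<gamma>\<close> has only \<open>k\<close> meaningful entries.
      Continuing it by a constant map gives an infinite sequence to which
      \<open>height_quotient_bound\<close> applies.\<close>
    obtain \<omega> where \<omega>: "\<omega> \<in> space S" "\<And>i. i < k \<Longrightarrow> \<omega> i = \<gamma> i"
    proof -
      obtain \<phi> where "\<phi> \<in> space M" using M.not_empty by blast
      then show ?thesis
        using space_fin[OF \<gamma>] by (intro that[of "\<lambda>i. if i < k then \<gamma> i else \<phi>"]) (auto simp: space_PiM)
    qed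
    let ?D = "seq_deg \<alpha> \<gamma> k" and ?Q = "act \<gamma> k P"
    have D: "1 \<le> ?D" using space_fin[OF \<gamma>] by (rule seq_deg_ge_1)
    have "height_quotient h \<alpha> P \<omega> k = h ?Q / ?D"
      using height_quotient_cong[where \<gamma> = \<omega> and \<gamma>' = \<gamma> and m = k] \<omega>(2) by (simp add: height_quotient_def)
    then have 1: "\<bar>h ?Q / ?D - h P\<bar> \<le> ?B"
      using height_quotient_bound[OF \<omega>(1) assms, of k] by simp
    have 2: "\<bar>?E \<gamma> - h ?Q\<bar> \<le> ?B"
      using space_fin[OF \<gamma>] assms by (intro expected_height_bound act_in)
    have "\<bar>(?E \<gamma> - h ?Q) / ?D\<bar> \<le> ?B / 1"
      unfolding abs_divide using 2 D by (intro frac_le) auto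
    with 1 show ?thesis
      by (simp add: diff_divide_distrib)
  qed
  then have int: "integrable ?N (\<lambda>\<gamma>. ?E \<gamma> / seq_deg \<alpha> \<gamma> k)"
    by (intro N.integrable_const_bound[where B = "\<bar>h P\<bar> + 2 * ?B"] AE_I2 borel_measurable_PiM_fin) auto
  have eq: "?w \<gamma> *\<^sub>R ?E \<gamma> = d_const M \<alpha> ^ k * (?E \<gamma> / seq_deg \<alpha> \<gamma> k)" for \<gamma>
    by simp
  show "integrable (nu_star M \<alpha> k) ?E"
    unfolding nu_star_eq_density
    by (subst integrable_density[OF borel_measurable_PiM_fin borel_measurable_PiM_fin w])
      (unfold eq, rule integrable_mult_right, rule int)
  have "(\<integral>\<gamma>. ?E \<gamma> \<partial>nu_star M \<alpha> k) = (\<integral>\<gamma>. d_const M \<alpha> ^ k * (?E \<gamma> / seq_deg \<alpha> \<gamma> k) \<partial>?N)"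
    unfolding nu_star_eq_density
    by (subst integral_density[OF borel_measurable_PiM_fin borel_measurable_PiM_fin w]) (unfold eq, rule refl)
  also have "\<dots> = d_const M \<alpha> ^ k * expected_height M h \<alpha> P"
    by (subst Bochner_Integration.integral_mult_right_zero) (simp only: expected_height_recursion[OF assms, of k])
  finally show "(\<integral>\<gamma>. ?E \<gamma> \<partial>nu_star M \<alpha> k) = d_const M \<alpha> ^ k * expected_height M h \<alpha> P" .
qed

end

section \<open>From height control to the canonical heights\<close>

theorem theorem1p2:
  fixes n :: nat
    and V :: "'k::field alg_closure ppoint set"
    and S :: "('k alg_closure ppoint \<Rightarrow> 'k alg_closure ppoint) set"
    and \<eta> :: "('k alg_closure line_bundle set \<Rightarrow>\<^sub>0 real) set"
    and h :: "'k alg_closure ppoint \<Rightarrow> real"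
    and \<alpha> :: "('k alg_closure ppoint \<Rightarrow> 'k alg_closure ppoint) \<Rightarrow> real"
    and \<nu>1 :: "('k alg_closure ppoint \<Rightarrow> 'k alg_closure ppoint) measure"
  assumes "global_field TYPE('k)"
    and "smooth_projective_variety n V"
    and "\<And>\<phi>. \<phi> \<in> S \<Longrightarrow> endomorphism_over n base_field V \<phi>"
    and "\<eta> \<in> tensor_reals (Pic n V)"
    and "weil_height n V \<eta> h"
    and "height_controlled n V \<eta> h S \<alpha>"
    and "prob_space \<nu>1" and "space \<nu>1 = S" and "sets \<nu>1 = Pow S"
  shows "(\<forall>\<gamma>\<in>UNIV \<rightarrow>\<^sub>E S. \<forall>P\<in>V. convergent (height_quotient h \<alpha> P \<gamma>)) \<and>
     (\<forall>P\<in>V. integrable (seq_measure \<nu>1) (canonical_height h \<alpha> P)) \<and>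
     (\<exists>C. \<forall>P\<in>V. \<bar>expected_height \<nu>1 h \<alpha> P - h P\<bar> \<le> C) \<and>
     (\<forall>k\<ge>1. prob_space (nu_star \<nu>1 \<alpha> k)) \<and>
     (\<forall>k\<ge>1. \<forall>P\<in>V.
        integrable (nu_star \<nu>1 \<alpha> k) (\<lambda>\<gamma>. expected_height \<nu>1 h \<alpha> (act \<gamma> k P)) \<and>
        (\<integral>\<gamma>. expected_height \<nu>1 h \<alpha> (act \<gamma> k P) \<partial>nu_star \<nu>1 \<alpha> k)
          = d_const \<nu>1 \<alpha> ^ k * expected_height \<nu>1 h \<alpha> P)"
proof -
  have irr: "irreducible_closed n V"
    using assms(2) by (simp add: smooth_projective_variety_def)
  have "S \<subseteq> {\<phi>. endomorphism_over n base_field V \<phi>}"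
    using assms(3) by blast
  then have "countable S"
    using countable_endomorphisms_base_field[OF assms(1) irr] by (rule countable_subset)
  \<comment> \<open>A real strictly between 1 and the infimum lies below every eigenvalue and keeps
    the ratio \<open>1 / a\<close> below 1.\<close>
  obtain a :: real where a: "1 < ereal a" "ereal a < (INF \<phi>\<in>S. ereal (\<alpha> \<phi>))"
    using assms(6) ereal_dense2 unfolding height_controlled_def by blast
  \<comment> \<open>The supremum is an extended real below infinity; a real number above it bounds
    all defects at once.\<close>
  obtain C :: real where C: "(SUP \<phi>\<in>S. height_defect V h (\<alpha> \<phi>) \<phi>) < ereal C"
    using assms(6) ereal_dense2 unfolding height_controlled_def by blast
  interpret random_orbit_heights \<nu>1 V h \<alpha> a C
  proof (intro random_orbit_heights.intro sequence_space.intro random_orbit_heights_axioms.intro)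
    show "product_prob_space (\<lambda>i :: nat. \<nu>1)"
      by (intro product_prob_spaceI assms(7))
    show "countable (space \<nu>1)" "sets \<nu>1 = Pow (space \<nu>1)" "1 < a"
      using \<open>countable S\<close> assms(8,9) a(1) by auto
    fix \<phi> assume "\<phi> \<in> space \<nu>1"
    then have \<phi>: "\<phi> \<in> S" using assms(8) by simp
    show "a \<le> \<alpha> \<phi>"
      using less_INF_D[OF a(2) \<phi>] by simp
    fix P assume P: "P \<in> V"
    show "\<phi> P \<in> V"
      using assms(3)[OF \<phi>] P by (auto simp: endomorphism_over_def)
    have "ereal \<bar>h (\<phi> P) - \<alpha> \<phi> * h P\<bar> \<le> height_defect V h (\<alpha> \<phi>) \<phi>"
      unfolding height_defect_def using P by (rule SUP_upper)
    also have "\<dots> < ereal C"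
      using SUP_lessD[OF C \<phi>] .
    finally show "\<bar>h (\<phi> P) - \<alpha> \<phi> * h P\<bar> \<le> C" by simp
  qed
  show ?thesis
  \<comment> \<open>The witness for (a) is the sum of the geometric series bounding the successive
    changes of the height quotient.\<close>
  proof (intro conjI allI ballI impI exI[of _ "C / (a - 1)"])
    fix \<gamma> :: "nat \<Rightarrow> _" and P assume "\<gamma> \<in> UNIV \<rightarrow>\<^sub>E S" "P \<in> V"
    then show "convergent (height_quotient h \<alpha> P \<gamma>)"
      using assms(8) by (intro height_quotient_convergent) (simp_all add: space_PiM)
  next
    fix P assume "P \<in> V"
    then show "integrable (seq_measure \<nu>1) (canonical_height h \<alpha> P)"
      unfolding seq_measure_def by (rule integrable_canonical_height)
  qed (auto intro: expected_height_bound prob_space_nu_star expected_height_nu_star)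
qed

end
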